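(* Let $S$ be a set of $n$ keys drawn independently and uniformly at random from the integer universe $[u]=\{0,\dots,u-1\}$, with $u=2^w$ in the $w$-bit word RAM model. The LeMonHash data structure built on $S$ with the linear bucket mapper (which maps a key $x$ to bucket $\lfloor xn/u\rfloor$) uses on average $\approx n(2.91536+o(1))$ bits of space, and it answers queries (returning the rank in $S$ of a query key $q\in S$) in constant time.
   Context: A monotone minimal perfect hash function (MMPHF) on a set $S$ of $n$ keys from an ordered universe maps each key of $S$ to its rank in $S$ (arbitrary output on keys not in $S$). LeMonHash is the following MMPHF for integer keys. A monotone bucket mapper maps each key to one of $n$ buckets $0,\dots,n-1$. The global rank of the first key of each bucket (equivalently, the prefix sums of bucket sizes) is stored as a non-decreasing sequence in Elias-Fano coding, using $2n+o(n)$ bits and supporting constant-time access via select on bit vectors; the size $b$ of a bucket is obtained as the difference of consecutive entries. For each bucket of size $b\ge 2$, the local rank (rank within the bucket) of each of its keys is stored in a retrieval data structure of value width $\lceil\log_2 b\rceil$ bits; all keys in buckets with the same value $i=\lceil\log_2 b\rceil$ share the $i$-th retrieval data structure; buckets of size $0$ or $1$ store nothing. A retrieval data structure (static function) on a key set maps each of its keys to a stored $r$-bit value (arbitrary output on other keys); here it is assumed to use $rn'+o(n')$ bits for $n'$ keys and to answer queries in constant time. A query for $q$ computes its bucket $i$, reads the bucket's global rank and size $b$ from the Elias-Fano sequence, queries the $\lceil\log_2 b\rceil$-th retrieval structure for the local rank of $q$ (if $b\ge 2$), and returns global rank plus local rank. Logarithms are base 2.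
   Formalization: The space bound is stated for u/n tending to infinity (for u = n all buckets have size 1 and the space is only about 2n bits), and the query claim for 2|S| < u, so that positions in the Elias-Fano bit vector fit into a w-bit word. *)

theory Defs
  imports "HOL-Probability.Probability" "HOL-Library.Landau_Symbols"
    "HOL-Library.Discrete_Functions"
begin

definition clog2 :: "nat \<Rightarrow> nat" where
  "clog2 b = nat \<lceil>log 2 (real b)\<rceil>"

definition key_rank :: "nat set \<Rightarrow> nat \<Rightarrow> nat" where
  "key_rank S x = card {y \<in> S. y < x}"


section \<open>Unit-cost word RAM\<close>

text \<open>A computation is a result paired with the number of elementary steps spent on it.
  Words are naturals below \<open>2 ^ w\<close>; every word operation costs one step and wraps
  around modulo \<open>2 ^ w\<close>.\<close>

type_synonym 'a timed = "'a \<times> nat"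

definition ret :: "'a \<Rightarrow> 'a timed" where
  "ret x = (x, 0)"

definition bind_timed :: "'a timed \<Rightarrow> ('a \<Rightarrow> 'b timed) \<Rightarrow> 'b timed"  (infixl ">>>" 54) where
  "m >>> f = (case m of (x, s) \<Rightarrow> (case f x of (y, t) \<Rightarrow> (y, s + t)))"

definition load :: "'a \<Rightarrow> 'a timed" where
  "load x = (x, 1)"

definition w_add :: "nat \<Rightarrow> nat \<Rightarrow> nat \<Rightarrow> nat timed" where
  "w_add w x y = ((x + y) mod 2 ^ w, 1)"

definition w_sub :: "nat \<Rightarrow> nat \<Rightarrow> nat \<Rightarrow> nat timed" where
  "w_sub w x y = ((x + (2 ^ w - y)) mod 2 ^ w, 1)"

text \<open>High word of the double-word product.\<close>

definition w_mulhi :: "nat \<Rightarrow> nat \<Rightarrow> nat \<Rightarrow> nat timed" where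
  "w_mulhi w x y = (x * y div 2 ^ w, 1)"

text \<open>Index of the most significant set bit.\<close>

definition w_msb :: "nat \<Rightarrow> nat timed" where
  "w_msb x = (floor_log x, 1)"

definition w_le :: "nat \<Rightarrow> nat \<Rightarrow> bool timed" where
  "w_le x y = (x \<le> y, 1)"


section \<open>Assumed building blocks\<close>

text \<open>Both building blocks are black boxes: the type of the stored object, its size in bits and
  the step count of its query are parameters, constrained only by the predicates below.
  The first argument \<open>w\<close> is always the word size.

  The size is a parameter, rather than the length of a bit string that determines all answers,
  because retrieval structures are analysed with hash functions that are not charged for.
  Without these, no bound of the form \<open>r * n' + o(n')\<close> can hold uniformly in the size of the key
  universe (already two keys need \<open>\<Omega>(log w)\<close> bits), and the assumption would be contradictory.\<close>

text \<open>Position of the \<open>j\<close>-th one (counting from \<open>0\<close>).\<close>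

definition select1 :: "bool list \<Rightarrow> nat \<Rightarrow> nat" where
  "select1 B j = filter (\<lambda>p. B ! p) [0..<length B] ! j"

record 's select_impl =
  sel_build :: "nat \<Rightarrow> bool list \<Rightarrow> 's"
  sel_query :: "nat \<Rightarrow> bool list \<Rightarrow> 's \<Rightarrow> nat \<Rightarrow> nat timed"
  sel_bits :: "'s \<Rightarrow> nat"

definition select_structure :: "'s select_impl \<Rightarrow> bool" where
  "select_structure I \<longleftrightarrow>
     (\<exists>(g :: nat \<Rightarrow> real) t. g \<in> o(\<lambda>N. real N) \<and>
       (\<forall>w B. length B \<le> 2 ^ w \<longrightarrow>
          real (sel_bits I (sel_build I w B)) \<le> g (length B) \<and>
          (\<forall>j < count_list B True.
             fst (sel_query I w B (sel_build I w B) j) = select1 B j \<and>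
             snd (sel_query I w B (sel_build I w B) j) \<le> t)))"

text \<open>\<open>ret_build I w r K f\<close> stores the \<open>r\<close>-bit values \<open>f x\<close> of the keys \<open>x \<in> K\<close>.\<close>

record 'r retrieval_impl =
  ret_build :: "nat \<Rightarrow> nat \<Rightarrow> nat set \<Rightarrow> (nat \<Rightarrow> nat) \<Rightarrow> 'r"
  ret_query :: "nat \<Rightarrow> 'r \<Rightarrow> nat \<Rightarrow> nat timed"
  ret_bits :: "'r \<Rightarrow> nat"

text \<open>The term \<open>o(n')\<close> in the size is a two-sided error term, uniform in the value width.\<close>

definition retrieval_structure :: "'r retrieval_impl \<Rightarrow> bool" where
  "retrieval_structure I \<longleftrightarrow>
     (\<exists>(g :: nat \<Rightarrow> real) t. g \<in> o(\<lambda>n'. real n') \<and>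
       (\<forall>w r K f. K \<subseteq> {..<2 ^ w} \<and> r \<le> w \<and> (\<forall>x\<in>K. f x < 2 ^ r) \<longrightarrow>
          \<bar>real (ret_bits I (ret_build I w r K f)) - real (r * card K)\<bar> \<le> g (card K) \<and>
          (\<forall>x\<in>K. fst (ret_query I w (ret_build I w r K f) x) = f x \<and>
                 snd (ret_query I w (ret_build I w r K f) x) \<le> t)))"


section \<open>Elias-Fano coding of the bucket offsets\<close>

text \<open>Elias-Fano coding of \<open>m\<close> non-decreasing values from a universe of size \<open>U\<close> stores the lower
  \<open>\<lfloor>log\<^sub>2 (U / m)\<rfloor>\<close> bits of each value verbatim and the remaining upper parts in a bit vector, in
  which the upper part \<open>v\<close> of the \<open>i\<close>-th value sets position \<open>v + i\<close>.  Here there are \<open>n + 1\<close>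
  offsets from \<open>{0..n}\<close>, so that there are no lower bits and the upper part is the value itself.\<close>

definition ef_encode :: "nat \<Rightarrow> nat list \<Rightarrow> bool list" where
  "ef_encode vmax vs = map (\<lambda>p. \<exists>i < length vs. p = vs ! i + i) [0..<vmax + length vs]"

definition ef_access :: "'s select_impl \<Rightarrow> nat \<Rightarrow> bool list \<Rightarrow> 's \<Rightarrow> nat \<Rightarrow> nat timed" where
  "ef_access I w B s i = sel_query I w B s i >>> (\<lambda>p. w_sub w p i)"


section \<open>LeMonHash with the linear bucket mapper\<close>

definition linear_mapper :: "nat \<Rightarrow> nat \<Rightarrow> nat \<Rightarrow> nat" where
  "linear_mapper u n x = nat \<lfloor>real x * real n / real u\<rfloor>"

definition bucket :: "(nat \<Rightarrow> nat) \<Rightarrow> nat set \<Rightarrow> nat \<Rightarrow> nat set" where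
  "bucket \<beta> S i = {x \<in> S. \<beta> x = i}"

definition bucket_offsets :: "(nat \<Rightarrow> nat) \<Rightarrow> nat set \<Rightarrow> nat list" where
  "bucket_offsets \<beta> S = map (\<lambda>i. \<Sum>j<i. card (bucket \<beta> S j)) [0..<card S + 1]"

definition level_keys :: "(nat \<Rightarrow> nat) \<Rightarrow> nat set \<Rightarrow> nat \<Rightarrow> nat set" where
  "level_keys \<beta> S i =
     {x \<in> S. card (bucket \<beta> S (\<beta> x)) \<ge> 2 \<and> clog2 (card (bucket \<beta> S (\<beta> x))) = i}"

definition local_rank :: "(nat \<Rightarrow> nat) \<Rightarrow> nat set \<Rightarrow> nat \<Rightarrow> nat" where
  "local_rank \<beta> S x = key_rank (bucket \<beta> S (\<beta> x)) x"

text \<open>The number of keys is all that is needed to evaluate the linear mapper.\<close>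

record ('s, 'r) lemonhash =
  num_keys :: nat
  offset_code :: "bool list"
  offset_select :: 's
  local_ranks :: "nat \<Rightarrow> 'r"

definition lemonhash_build ::
  "'s select_impl \<Rightarrow> 'r retrieval_impl \<Rightarrow> nat \<Rightarrow> nat set \<Rightarrow> ('s, 'r) lemonhash" where
  "lemonhash_build I J w S =
     (let n = card S; \<beta> = linear_mapper (2 ^ w) n; B = ef_encode n (bucket_offsets \<beta> S) in
        \<lparr>num_keys = n,
         offset_code = B,
         offset_select = sel_build I w B,
         local_ranks = (\<lambda>i. ret_build J w i (level_keys \<beta> S i) (local_rank \<beta> S))\<rparr>)"

text \<open>Buckets have at most \<open>n\<close> keys, so only the retrieval structures \<open>1, \<dots>, clog2 n\<close> exist.\<close>

definition lemonhash_bits ::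
  "'s select_impl \<Rightarrow> 'r retrieval_impl \<Rightarrow> ('s, 'r) lemonhash \<Rightarrow> nat" where
  "lemonhash_bits I J L =
     clog2 (num_keys L + 1) +
     length (offset_code L) + sel_bits I (offset_select L) +
     (\<Sum>i = 1..clog2 (num_keys L). ret_bits J (local_ranks L i))"

text \<open>For \<open>b \<ge> 2\<close> the level \<open>\<lceil>log\<^sub>2 b\<rceil>\<close> is the bit length of \<open>b - 1\<close>.\<close>

definition lemonhash_query ::
  "'s select_impl \<Rightarrow> 'r retrieval_impl \<Rightarrow> nat \<Rightarrow> ('s, 'r) lemonhash \<Rightarrow> nat \<Rightarrow> nat timed" where
  "lemonhash_query I J w L q =
     load (num_keys L) >>> (\<lambda>n.
     w_mulhi w q n >>> (\<lambda>i.
     w_add w i 1 >>> (\<lambda>i'.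
     ef_access I w (offset_code L) (offset_select L) i >>> (\<lambda>a.
     ef_access I w (offset_code L) (offset_select L) i' >>> (\<lambda>a'.
     w_sub w a' a >>> (\<lambda>b.
     w_le 2 b >>> (\<lambda>large.
     if large then
       w_sub w b 1 >>> (\<lambda>b'.
       w_msb b' >>> (\<lambda>k.
       w_add w k 1 >>> (\<lambda>level.
       load (local_ranks L level) >>> (\<lambda>R.
       ret_query J w R q >>> (\<lambda>r.
       w_add w a r)))))
     else ret a)))))))"


section \<open>Random key sets\<close>

definition iid_draws :: "nat \<Rightarrow> nat \<Rightarrow> (nat \<Rightarrow> nat) pmf" where
  "iid_draws u n = Pi_pmf {..<n} 0 (\<lambda>_. pmf_of_set {..<u})"

text \<open>Two readings of a set of \<open>n\<close> independent uniform keys: the draws are conditioned on being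
  pairwise distinct, so that there are exactly \<open>n\<close> keys (meaningful for \<open>n \<le> u\<close>), or repeated
  draws are merged.\<close>

definition distinct_key_set :: "nat \<Rightarrow> nat \<Rightarrow> nat set pmf" where
  "distinct_key_set u n =
     map_pmf (\<lambda>X. X ` {..<n}) (cond_pmf (iid_draws u n) {X. inj_on X {..<n}})"

definition merged_key_set :: "nat \<Rightarrow> nat \<Rightarrow> nat set pmf" where
  "merged_key_set u n = map_pmf (\<lambda>X. X ` {..<n}) (iid_draws u n)"

end

theory Submission
  imports Defs
begin

text \<open>Up to lower order terms the space of a set of \<open>m\<close> keys is \<open>2 * m\<close> bits of Elias-Fano code plus
  the sum of \<open>h b = b * clog2 b\<close> over the bucket sizes \<open>b\<close>; the error of the logarithmically many
  retrieval structures is \<open>o(m)\<close> because each contributes at most \<open>\<epsilon> * n' + C\<close>.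

  Both models of random keys are exchangeable: given its cardinality \<open>m\<close>, the key set is a uniform
  \<open>m\<close>-subset of the universe, so that bucket sizes are hypergeometric.  Expanding
  \<open>h b = (\<Sum>k. a k * (b choose k))\<close> reduces the mean of \<open>h\<close> to the binomial moments
  \<open>(s choose k) * (m choose k) / (u choose k)\<close> of a bucket of \<open>s \<approx> u / m\<close> universe elements.  These tend to
  \<open>1 / fact k\<close> and are dominated, so by Tannery's theorem the mean converges, uniformly over the
  buckets, to \<open>(\<Sum>k. a k / fact k) = exp (- 1) * (\<Sum>b. h b / fact b)\<close>, the Poisson mean of \<open>h\<close>.
  Merging repeated draws loses at most \<open>n\<^sup>2 / u = o(n)\<close> keys in expectation.\<close>

section \<open>The ceiling of the binary logarithm\<close>

lemma clog2_le_1 [simp]: "b \<le> 1 \<Longrightarrow> clog2 b = 0"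
  by (cases b) (auto simp: clog2_def log_def)

text \<open>With \<open>k = floor_log (b - 1)\<close>, integrality gives
  \<open>2 ^ k < b \<le> 2 ^ (k + 1)\<close>. This is what lets a query find the level with a single
  most-significant-bit operation.\<close>

lemma clog2_eq_floor_log: "b \<ge> 2 \<Longrightarrow> clog2 b = floor_log (b - 1) + 1"
proof -
  assume b: "b \<ge> 2"
  define k where "k = floor_log (b - 1)"
  have 1: "2 ^ k \<le> b - 1" unfolding k_def using b by (intro floor_log_exp2_le) auto
  have 2: "b - 1 < 2 * 2 ^ k" unfolding k_def by (rule floor_log_exp2_gt)
  have lo: "2 powr real k < real b"
  proof -
    have "2 ^ k < b" using 1 b by linarith
    hence "real (2 ^ k) < real b" by (simp only: of_nat_less_iff)
    thus ?thesis by (simp add: powr_realpow)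
  qed
  have "b \<le> 2 * 2 ^ k" using 2 by linarith
  hence "real b \<le> real (2 * 2 ^ k)" by (rule of_nat_mono)
  hence hi: "real b \<le> 2 powr real (Suc k)" by (simp add: powr_realpow powr_add)
  have "\<lceil>log 2 (real b)\<rceil> = int (Suc k)"
  proof (rule ceiling_unique)
    show "real_of_int (int (Suc k)) - 1 < log 2 (real b)" using lo b by (simp add: less_log_iff)
    show "log 2 (real b) \<le> real_of_int (int (Suc k))" using hi b by (simp add: log_le_iff)
  qed
  thus ?thesis by (simp add: clog2_def k_def)
qed

lemma le_two_power_clog2: "b \<le> 2 ^ clog2 b"
proof (cases "b \<ge> 2")
  case True
  with floor_log_exp2_gt[of "b - 1"] show ?thesis by (simp add: clog2_eq_floor_log)
qed (cases b; simp)

text \<open>A Galois connection with the powers of two: from here on, monotonicity and crude bounds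
  need no real logarithms.\<close>

lemma clog2_le_iff: "clog2 b \<le> k \<longleftrightarrow> b \<le> 2 ^ k"
proof
  assume "clog2 b \<le> k"
  hence "(2::nat) ^ clog2 b \<le> 2 ^ k" by (simp add: power_increasing)
  thus "b \<le> 2 ^ k" using le_two_power_clog2[of b] by linarith
next
  assume b: "b \<le> 2 ^ k"
  show "clog2 b \<le> k"
  proof (cases "b \<ge> 2")
    case True
    hence "2 ^ floor_log (b - 1) \<le> b - 1" by (intro floor_log_exp2_le) auto
    also have "b - 1 < 2 ^ k" using b True by linarith
    finally have "floor_log (b - 1) < k" by (simp add: power_strict_increasing_iff)
    thus ?thesis using True by (simp add: clog2_eq_floor_log)
  qed simp
qed

lemma clog2_mono: "a \<le> b \<Longrightarrow> clog2 a \<le> clog2 b"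
  using clog2_le_iff le_two_power_clog2 order_trans by blast

lemma clog2_le_self: "clog2 b \<le> b"
  by (simp add: clog2_le_iff less_imp_le)

section \<open>Newton expansions and hypergeometric means\<close>

text \<open>The \<open>k\<close>-th forward difference of \<open>h\<close> at 0, that is, the
  \<open>k\<close>-th coefficient in Newton's forward interpolation formula.\<close>

definition newton_coeff :: "(nat \<Rightarrow> real) \<Rightarrow> nat \<Rightarrow> real" where
  "newton_coeff h k = (\<Sum>j\<le>k. (-1) ^ (k - j) * real (k choose j) * h j)"

text \<open>Binomial inversion: after exchanging the two sums over the triangle
  \<open>j \<le> k \<le> b\<close>, the coefficient of \<open>h j\<close> is an alternating sum that
  vanishes unless \<open>j = b\<close>.\<close>

lemma newton_expansion: "h b = (\<Sum>k\<le>b. newton_coeff h k * real (b choose k))"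
proof -
  \<comment> \<open>Trinomial revision pulls out \<open>b choose j\<close> and leaves an alternating
    row sum of Pascal's triangle.\<close>
  have inner: "(\<Sum>k=j..b. (-1) ^ (k - j) * real (b choose k) * real (k choose j)) = (if j = b then 1 else 0)"
    if "j \<le> b" for j
  proof -
    have "(\<Sum>k=j..b. (-1) ^ (k - j) * real (b choose k) * real (k choose j))
        = (\<Sum>k=j..b. real (b choose j) * ((-1) ^ (k - j) * real ((b - j) choose (k - j))))"
    proof (intro sum.cong refl)
      fix k assume "k \<in> {j..b}"
      hence "real (b choose k) * real (k choose j) = real (b choose j) * real ((b - j) choose (k - j))"
        by (simp add: choose_mult flip: of_nat_mult)
      thus "(-1) ^ (k - j) * real (b choose k) * real (k choose j)
          = real (b choose j) * ((-1) ^ (k - j) * real ((b - j) choose (k - j)))"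
        by (simp add: mult.assoc mult.left_commute)
    qed
    also have "\<dots> = real (b choose j) * (\<Sum>i\<le>b - j. (-1) ^ i * real ((b - j) choose i))"
      unfolding sum_distrib_left
      by (rule sum.reindex_bij_witness[of _ "\<lambda>i. i + j" "\<lambda>k. k - j"]) (use that in auto)
    also have "\<dots> = (if j = b then 1 else 0)"
      using that by (auto simp: choose_alternating_sum)
    finally show ?thesis .
  qed
  have "(\<Sum>k\<le>b. newton_coeff h k * real (b choose k))
      = (\<Sum>k\<le>b. \<Sum>j\<le>k. h j * ((-1) ^ (k - j) * real (b choose k) * real (k choose j)))"
    by (simp add: newton_coeff_def sum_distrib_left sum_distrib_right algebra_simps)
  also have "\<dots> = (\<Sum>j\<le>b. \<Sum>k=j..b. h j * ((-1) ^ (k - j) * real (b choose k) * real (k choose j)))"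
    unfolding sum.Sigma[OF finite_atMost ballI[OF finite_atMost]] sum.Sigma[OF finite_atMost ballI[OF finite_atLeastAtMost]]
    by (rule sum.reindex_bij_witness[of _ "\<lambda>(j, k). (k, j)" "\<lambda>(k, j). (j, k)"]) auto
  also have "\<dots> = (\<Sum>j\<le>b. h j * (if j = b then 1 else 0))"
    by (intro sum.cong refl) (simp add: inner flip: sum_distrib_left)
  also have "\<dots> = h b" by (simp add: if_distrib[of "\<lambda>x. h _ * x"] cong: if_cong)
  finally show ?thesis ..
qed

text \<open>The binomial theorem keeps the growth geometric, so that division by
  \<open>fact k\<close> yields a summable majorant.\<close>

lemma abs_newton_coeff_le:
  assumes "\<And>j. \<bar>h j\<bar> \<le> B ^ j"
  shows "\<bar>newton_coeff h k\<bar> \<le> (B + 1) ^ k"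
proof -
  have "\<bar>newton_coeff h k\<bar> \<le> (\<Sum>j\<le>k. \<bar>(-1) ^ (k - j) * real (k choose j) * h j\<bar>)"
    unfolding newton_coeff_def by (rule sum_abs)
  also have "\<dots> \<le> (\<Sum>j\<le>k. real (k choose j) * B ^ j)"
    by (intro sum_mono) (simp add: abs_mult power_abs mult_left_mono assms)
  also have "\<dots> = (B + 1) ^ k" by (simp add: binomial_ring)
  finally show ?thesis .
qed

text \<open>The terms are those of the Cauchy product of the series of \<open>h j / fact j\<close>
  with the exponential series at -1. The limit is the mean of \<open>h\<close> under the Poisson
  distribution with parameter 1.\<close>

lemma newton_coeff_series:
  assumes "\<And>j. \<bar>h j\<bar> \<le> B ^ j"
  shows "(\<lambda>k. newton_coeff h k / fact k) sums ((\<Sum>j. h j / fact j) * exp (- 1))"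
proof -
  have "summable (\<lambda>j. B ^ j / fact j)"
    using summable_exp[of B] by (simp add: field_simps)
  hence h: "summable (\<lambda>j. norm (h j / fact j))"
    by (rule summable_comparison_test'[where N = 0]) (simp add: assms divide_right_mono)
  have e: "summable (\<lambda>j. norm ((- 1) ^ j / fact j :: real))"
    using summable_exp[of "1::real"] by (simp add: field_simps)
  have "(\<Sum>j\<le>k. h j / fact j * ((- 1) ^ (k - j) / fact (k - j))) = newton_coeff h k / fact k" for k
    unfolding newton_coeff_def sum_divide_distrib
    by (intro sum.cong refl) (simp add: binomial_fact field_simps)
  moreover have "(\<Sum>j. (- 1) ^ j / fact j :: real) = exp (- 1)"
    by (simp add: exp_def field_simps scaleR_conv_of_real)
  ultimately show ?thesis using Cauchy_product_sums[OF h e] by simp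
qed

section \<open>Limits of binomial moments\<close>

text \<open>Each factor satisfies \<open>(s - i) / (u - i) \<le> s / u\<close> because
  \<open>s \<le> u\<close>; the factors are compared after cross-multiplication. For
  \<open>k > s\<close> the left side is 0.\<close>

lemma binomial_quotient_le:
  assumes "s \<le> u"
  shows "real (s choose k) / real (u choose k) \<le> (real s / real u) ^ k"
proof (cases "k \<le> s")
  case True
  have "(\<Prod>i<k. real (s - i)) * real u ^ k \<le> (\<Prod>i<k. real (u - i)) * real s ^ k"
  proof -
    have "(\<Prod>i<k. real (s - i) * real u) \<le> (\<Prod>i<k. real (u - i) * real s)"
    proof (intro prod_mono conjI)
      fix i assume i: "i \<in> {..<k}"
      have "real i * real s \<le> real i * real u" using assms by (simp add: mult_left_mono)
      thus "real (s - i) * real u \<le> real (u - i) * real s"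
        using i True assms by (simp add: of_nat_diff algebra_simps)
    qed simp
    thus ?thesis by (simp add: prod.distrib)
  qed
  moreover have "real (x choose k) = (\<Prod>i<k. real (x - i)) / fact k" if "k \<le> x" for x
    using that by (simp add: binomial_gbinomial gbinomial_prod_rev of_nat_diff atLeast0LessThan)
  moreover have "(\<Prod>i<k. real (u - i)) > 0" using True assms by (intro prod_pos) auto
  moreover have "real u ^ k > 0" using True assms by (cases k) auto
  moreover have "k \<le> u" using True assms by simp
  ultimately show ?thesis using True
    by (simp add: power_divide frac_le_eq pos_divide_le_eq pos_le_divide_eq mult.commute)
qed (simp add: binomial_eq_0)

text \<open>The quotient is the product of the \<open>k\<close> factors \<open>1 - i / f n\<close>,
  each of which tends to 1.\<close>

lemma binomial_asymp:
  assumes "filterlim f at_top F"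
  shows "((\<lambda>n. real (f n choose k) * fact k / real (f n) ^ k) \<longlongrightarrow> 1) F"
proof -
  have "((\<lambda>n. \<Prod>i<k. 1 - real i / real (f n)) \<longlongrightarrow> (\<Prod>i<k. 1 - 0)) F"
    by (intro tendsto_prod tendsto_diff[OF tendsto_const] real_tendsto_divide_at_top[OF tendsto_const]
          filterlim_compose[OF filterlim_real_sequentially assms])
  moreover have "eventually (\<lambda>n. f n \<ge> Suc k) F"
    using assms by (simp add: filterlim_at_top)
  hence "eventually (\<lambda>n. (\<Prod>i<k. 1 - real i / real (f n)) = real (f n choose k) * fact k / real (f n) ^ k) F"
  proof eventually_elim
    case (elim n)
    have "(\<Prod>i<k. 1 - real i / real (f n)) = (\<Prod>i<k. (real (f n) - real i) / real (f n))"
      using elim by (intro prod.cong refl) (auto simp: field_simps)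
    also have "\<dots> = (\<Prod>i<k. real (f n) - real i) / real (f n) ^ k" by (simp add: prod_dividef)
    also have "\<dots> = real (f n choose k) * fact k / real (f n) ^ k"
      by (simp add: binomial_gbinomial gbinomial_prod_rev atLeast0LessThan)
    finally show ?case .
  qed
  ultimately show ?thesis by (simp add: tendsto_cong)
qed

text \<open>The mean of \<open>h\<close> under the hypergeometric distribution (\<open>s\<close> marked elements among \<open>u\<close>, \<open>m\<close>
  draws), written as a series over the binomial moments.\<close>

definition hyp_series :: "(nat \<Rightarrow> real) \<Rightarrow> nat \<Rightarrow> nat \<Rightarrow> nat \<Rightarrow> real" where
  "hyp_series h u s m =
     (\<Sum>k. newton_coeff h k * (real (s choose k) * real (m choose k) / real (u choose k)))"

text \<open>Tannery's theorem: every term converges to \<open>newton_coeff h k / fact k\<close>, and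
  one exponential series dominates all the terms once \<open>s * m / u\<close> is below 2.\<close>

lemma hyp_series_tendsto:
  assumes h: "\<And>j. \<bar>h j\<bar> \<le> B ^ j" and "B \<ge> 0"
    and s: "filterlim s at_top sequentially" and m: "filterlim m at_top sequentially"
    and su: "\<And>n. s n \<le> u n"
    and lim: "(\<lambda>n. real (s n) * real (m n) / real (u n)) \<longlonglongrightarrow> 1"
  shows "(\<lambda>n. hyp_series h (u n) (s n) (m n)) \<longlonglongrightarrow> (\<Sum>j. h j / fact j) * exp (- 1)"
proof -
  have u: "filterlim u at_top sequentially"
    using filterlim_at_top_mono[OF s] su by simp
  define a where "a = (\<lambda>k n. newton_coeff h k *
    (real (s n choose k) * real (m n choose k) / real (u n choose k)))"
  have pos: "eventually (\<lambda>n. f n \<ge> Suc k) sequentially"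
    if "filterlim f at_top sequentially" for f :: "nat \<Rightarrow> nat" and k
    using that by (simp add: filterlim_at_top)
  have limit: "a k \<longlonglongrightarrow> newton_coeff h k / fact k" for k
  proof -
    \<comment> \<open>The term is rewritten as a power of \<open>s * m / u\<close> times three
      ratios of a binomial coefficient to its leading power, whose limits are all 1.\<close>
    have "(\<lambda>n. newton_coeff h k * ((real (s n) * real (m n) / real (u n)) ^ k
        * (real (s n choose k) * fact k / real (s n) ^ k)
        * (real (m n choose k) * fact k / real (m n) ^ k)
        / (real (u n choose k) * fact k / real (u n) ^ k) / fact k)) \<longlonglongrightarrow>
      newton_coeff h k * (1 ^ k * 1 * 1 / 1 / fact k)"
      by (intro tendsto_intros lim binomial_asymp s m u) auto
    moreover have "eventually (\<lambda>n. newton_coeff h k * ((real (s n) * real (m n) / real (u n)) ^ k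
        * (real (s n choose k) * fact k / real (s n) ^ k)
        * (real (m n choose k) * fact k / real (m n) ^ k)
        / (real (u n choose k) * fact k / real (u n) ^ k) / fact k) = a k n) sequentially"
      using pos[OF s, of k] pos[OF m, of k] pos[OF u, of k]
    proof eventually_elim
      case (elim n)
      have "(u n choose k) > 0" using elim by (simp add: zero_less_binomial)
      thus ?case using elim by (simp add: a_def power_divide power_mult_distrib field_simps)
    qed
    ultimately show ?thesis by (simp add: tendsto_cong)
  qed
  \<comment> \<open>Any bound above the limit 1 would do here; 2 reappears in the majorant.\<close>
  have "eventually (\<lambda>n. real (s n) * real (m n) / real (u n) < 2) sequentially"
    using order_tendstoD(2)[OF lim, of 2] by simp
  hence "eventually (\<lambda>n. \<forall>k. norm (a k n) \<le> (2 * (B + 1)) ^ k / fact k) sequentially"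
  proof eventually_elim
    case (elim n)
    show ?case
    proof
      fix k
      have "real (s n choose k) * real (m n choose k) / real (u n choose k)
          = (real (s n choose k) / real (u n choose k)) * real (m n choose k)" by simp
      also have "\<dots> \<le> (real (s n) / real (u n)) ^ k * (real (m n) ^ k / fact k)"
      proof (intro mult_mono binomial_quotient_le su)
        have "real (m n choose k) * fact k \<le> real (m n) ^ k"
          using binomial_fact_pow[of "m n" k] by (metis of_nat_le_iff of_nat_mult of_nat_fact of_nat_power)
        thus "real (m n choose k) \<le> real (m n) ^ k / fact k" by (simp add: field_simps)
      qed auto
      also have "\<dots> = (real (s n) * real (m n) / real (u n)) ^ k / fact k"
        by (simp add: power_divide power_mult_distrib)
      also have "\<dots> \<le> 2 ^ k / fact k"
        using elim by (intro divide_right_mono power_mono) auto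
      finally have "real (s n choose k) * real (m n choose k) / real (u n choose k) \<le> 2 ^ k / fact k" .
      hence "norm (a k n) \<le> (B + 1) ^ k * (2 ^ k / fact k)"
        unfolding a_def real_norm_def abs_mult
        by (intro mult_mono abs_newton_coeff_le h) (use \<open>B \<ge> 0\<close> in auto)
      thus "norm (a k n) \<le> (2 * (B + 1)) ^ k / fact k" unfolding power_mult_distrib by (simp add: mult.commute)
    qed
  qed
  \<comment> \<open>Tannery's theorem expects a bound along the product filter; this one holds for
    all \<open>k\<close>, so the trivial predicate serves in the first component.\<close>
  hence bound: "eventually (\<lambda>(k, n). norm (a k n) \<le> (2 * (B + 1)) ^ k / fact k) (at_top \<times>\<^sub>F sequentially)"
    unfolding eventually_prod_filter
    by (intro exI[of _ "\<lambda>_. True"] exI conjI) auto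
  have "summable (\<lambda>k. (2 * (B + 1)) ^ k / fact k)"
    using summable_exp[of "2 * (B + 1)"] by (simp add: field_simps)
  from tannerys_theorem[OF limit bound this]
  have "(\<lambda>n. \<Sum>k. a k n) \<longlonglongrightarrow> (\<Sum>k. newton_coeff h k / fact k)" by simp
  thus ?thesis using sums_unique[OF newton_coeff_series[of h B, OF h]]
    by (simp add: hyp_series_def a_def)
qed

text \<open>Argued by contradiction: one counterexample for each \<open>N\<close> gives sequences
  that satisfy the hypotheses of the limit lemma yet stay away from its limit. The same
  \<open>N\<close> bounds \<open>s\<close> and \<open>m\<close> from below and sets the tolerance on
  \<open>s * m / u\<close>, so the required limits of these sequences come for free.\<close>

lemma hyp_series_uniform:
  assumes h: "\<And>j. \<bar>h j\<bar> \<le> B ^ j" and "B \<ge> 0" and "\<epsilon> > 0"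
  obtains N :: nat where "\<And>u s m. N \<le> s \<Longrightarrow> N \<le> m \<Longrightarrow> s \<le> u \<Longrightarrow>
      \<bar>real s * real m / real u - 1\<bar> \<le> 1 / real (Suc N) \<Longrightarrow>
      \<bar>hyp_series h u s m - (\<Sum>j. h j / fact j) * exp (- 1)\<bar> \<le> \<epsilon>"
proof (rule ccontr)
  assume "\<not> thesis"
  define Q where "Q N u s m \<longleftrightarrow> N \<le> s \<and> N \<le> m \<and> s \<le> u \<and>
      \<bar>real s * real m / real u - 1\<bar> \<le> 1 / real (Suc N) \<and>
      \<not> \<bar>hyp_series h u s m - (\<Sum>j. h j / fact j) * exp (- 1)\<bar> \<le> \<epsilon>" for N u s m
  have "\<forall>N. \<exists>u s m. Q N u s m"
    using \<open>\<not> thesis\<close> that unfolding Q_def by meson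
  then obtain u s m where "\<And>N. Q N (u N) (s N) (m N)" by metis
  hence usm: "\<And>N. N \<le> s N" "\<And>N. N \<le> m N" "\<And>N. s N \<le> u N"
      "\<And>N. \<bar>real (s N) * real (m N) / real (u N) - 1\<bar> \<le> 1 / real (Suc N)"
      "\<And>N. \<not> \<bar>hyp_series h (u N) (s N) (m N) - (\<Sum>j. h j / fact j) * exp (- 1)\<bar> \<le> \<epsilon>"
    unfolding Q_def by auto
  have "(\<lambda>N. 1 / real (Suc N)) \<longlonglongrightarrow> 0"
    using LIMSEQ_inverse_real_of_nat by (simp add: inverse_eq_divide)
  hence "(\<lambda>N. real (s N) * real (m N) / real (u N) - 1) \<longlonglongrightarrow> 0"
    by (rule Lim_null_comparison[rotated]) (use usm(4) in simp)
  hence "(\<lambda>N. real (s N) * real (m N) / real (u N)) \<longlonglongrightarrow> 1" by (simp add: LIM_zero_iff)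
  hence "(\<lambda>N. hyp_series h (u N) (s N) (m N)) \<longlonglongrightarrow> (\<Sum>j. h j / fact j) * exp (- 1)"
    by (intro hyp_series_tendsto[OF h \<open>B \<ge> 0\<close>] usm(3)
          filterlim_at_top_mono[OF filterlim_ident[where F = sequentially]]) (use usm in auto)
  from LIMSEQ_D[OF this \<open>\<epsilon> > 0\<close>] obtain N where
    "\<bar>hyp_series h (u N) (s N) (m N) - (\<Sum>j. h j / fact j) * exp (- 1)\<bar> < \<epsilon>" by auto
  with usm(5)[of N] show False by simp
qed

section \<open>The constant\<close>

text \<open>The retrieval payload of a bucket of size \<open>b\<close>. It is 0 for
  \<open>b \<le> 1\<close>, so buckets that store nothing need no separate treatment.\<close>

definition level_cost :: "nat \<Rightarrow> real" where
  "level_cost b = real b * real (clog2 b)"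

lemma abs_level_cost_le: "\<bar>level_cost b\<bar> \<le> 4 ^ b"
proof -
  have "real (b * clog2 b) \<le> real (2 ^ b * 2 ^ b)"
    using clog2_le_self[of b] less_exp[of b] by (intro of_nat_mono mult_mono) linarith+
  thus ?thesis by (simp add: level_cost_def flip: power_mult_distrib)
qed

text \<open>The mean of \<open>level_cost\<close> under the Poisson distribution with parameter
  1.\<close>

definition level_const :: real where
  "level_const = (\<Sum>b. level_cost b / fact b) * exp (- 1)"

text \<open>The tail is compared with a geometric series of ratio 1/2, whose sum supplies the factor
  2.\<close>

lemma suminf_approx:
  fixes f :: "nat \<Rightarrow> real"
  assumes "\<And>k. \<bar>f (k + N)\<bar> \<le> C * (1 / 2) ^ k"
  shows "summable f" and "\<bar>suminf f - sum f {..<N}\<bar> \<le> 2 * C"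
proof -
  have g: "(\<lambda>k. C * (1 / 2) ^ k) sums (C * 2)"
    using sums_mult[OF geometric_sums[of "1/2::real"], of C] by simp
  have s: "summable (\<lambda>k. \<bar>f (k + N)\<bar>)"
    by (rule summable_comparison_test'[OF sums_summable[OF g], of 0]) (use assms in auto)
  thus f: "summable f" using summable_rabs_cancel summable_iff_shift by blast
  have "\<bar>\<Sum>k. f (k + N)\<bar> \<le> (\<Sum>k. \<bar>f (k + N)\<bar>)" by (rule summable_rabs[OF s])
  also have "\<dots> \<le> C * 2" unfolding sums_unique[OF g] using s g assms by (intro suminf_le) (auto simp: sums_iff)
  finally show "\<bar>suminf f - sum f {..<N}\<bar> \<le> 2 * C" using suminf_minus_initial_segment[OF f, of N] by simp
qed

lemma fact_shift_ge: "real (fact (k + 14)) \<ge> fact 14 * 14 ^ k"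
proof (induction k)
  case (Suc k)
  have "fact 14 * 14 ^ Suc k = 14 * (fact 14 * 14 ^ k :: real)" by simp
  also have "\<dots> \<le> real (Suc (k + 14)) * real (fact (k + 14))" using Suc by (intro mult_mono) auto
  finally show ?case by (simp only: add_Suc fact_Suc of_nat_mult of_nat_fact of_nat_id)
qed simp

text \<open>The constant is a product of two series. Each is cut after 14 terms, where the partial
  sum is an exact rational, and the two resulting enclosures are multiplied.\<close>

lemma level_const_bounds: "\<bar>level_const - 0.91536\<bar> \<le> 0.000005"
proof -
  define S where "S = (\<Sum>b. level_cost b / fact b)"
  \<comment> \<open>Past index 14 the factorial gains at least a factor 14 per step against growth
    by 4, and \<open>4 * 2 \<le> 14\<close> leaves ratio 1/2.\<close>
  have shift: "a / fact (k + 14) \<le> C / fact 14 * (1 / 2) ^ k" if "a \<le> C * 4 ^ k" "C \<ge> 0" for a C :: real and k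
  proof -
    have "(4::real) ^ k * 2 ^ k \<le> 14 ^ k" by (simp add: power_mono flip: power_mult_distrib)
    hence "C * fact 14 * (4 ^ k * 2 ^ k) \<le> C * fact 14 * 14 ^ k"
      using that by (intro mult_left_mono) auto
    also have "\<dots> \<le> C * real (fact (k + 14))"
      using mult_left_mono[OF fact_shift_ge[of k] \<open>C \<ge> 0\<close>] by (simp add: mult_ac)
    finally have "C * 4 ^ k / real (fact (k + 14)) \<le> C / fact 14 * (1 / 2) ^ k"
      by (simp add: field_simps)
    moreover have "a / fact (k + 14) \<le> C * 4 ^ k / real (fact (k + 14))"
      using that by (simp add: divide_right_mono)
    ultimately show ?thesis by linarith
  qed
  have "\<bar>S - (\<Sum>b<14. level_cost b / fact b)\<bar> \<le> 2 * (196 / fact 14)"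
    unfolding S_def
  proof (rule suminf_approx(2))
    fix k
    have "k + 14 \<le> 14 * 2 ^ k" using less_exp[of k] by linarith
    hence "(k + 14) * clog2 (k + 14) \<le> (14 * 2 ^ k) * (14 * 2 ^ k)"
      using clog2_le_self[of "k + 14"] by (intro mult_mono) linarith+
    also have "\<dots> = 196 * 4 ^ k" by (simp flip: power_mult_distrib)
    finally have "real ((k + 14) * clog2 (k + 14)) \<le> real (196 * 4 ^ k)" by (rule of_nat_mono)
    hence "\<bar>level_cost (k + 14)\<bar> \<le> 196 * 4 ^ k" by (simp add: level_cost_def)
    from shift[OF this] show "\<bar>level_cost (k + 14) / fact (k + 14)\<bar> \<le> 196 / fact 14 * (1 / 2) ^ k"
      by simp
  qed
  \<comment> \<open>The summand for \<open>b\<close> is \<open>clog2 b / fact (b - 1)\<close>; the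
    first two vanish, so the list starts at \<open>b = 2\<close>.\<close>
  moreover have "(\<Sum>b<14. level_cost b / fact b)
      = 1 + 1 + 1 / 3 + 3 / 24 + 3 / 120 + 3 / 720 + 3 / 5040 + 4 / 40320 + 4 / 362880 + 4 / 3628800
        + 4 / 39916800 + 4 / 479001600"
    by (simp add: lessThan_nat_numeral level_cost_def clog2_eq_floor_log floor_log_rec fact_numeral)
  \<comment> \<open>The error bound is \<open>2 * 196 / fact 14\<close> in lowest terms.\<close>
  ultimately have "\<bar>S - 59592749 / 23950080\<bar> \<le> 1 / 222393600"
    by (simp add: fact_numeral)
  hence "S - 59592749 / 23950080 \<le> 1 / 222393600" "59592749 / 23950080 - S \<le> 1 / 222393600"
    by linarith+
  hence S: "2.488206 \<le> S" "S \<le> 2.488207"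
    by simp_all
  define E where "E = (\<Sum>b. (- 1) ^ b / fact b :: real)"
  have "\<bar>E - (\<Sum>b<14. (- 1) ^ b / fact b)\<bar> \<le> 2 * (1 / fact 14)"
    unfolding E_def
  proof (rule suminf_approx(2))
    fix k
    show "\<bar>(- 1) ^ (k + 14) / fact (k + 14) :: real\<bar> \<le> 1 / fact 14 * (1 / 2) ^ k"
      using shift[of 1 1 k] by (simp add: abs_divide)
  qed
  moreover have "(\<Sum>b<14. (- 1) ^ b / fact b :: real) = 1 - 1 + 1 / 2 - 1 / 6 + 1 / 24 - 1 / 120 + 1 / 720
      - 1 / 5040 + 1 / 40320 - 1 / 362880 + 1 / 3628800 - 1 / 39916800 + 1 / 479001600 - 1 / 6227020800"
    by (simp add: lessThan_nat_numeral fact_numeral)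
  ultimately have "\<bar>E - 63633137 / 172972800\<bar> \<le> 1 / 43589145600"
    by (simp add: fact_numeral)
  hence "E - 63633137 / 172972800 \<le> 1 / 43589145600" "63633137 / 172972800 - E \<le> 1 / 43589145600"
    by linarith+
  hence E: "0.3678794 \<le> E" "E \<le> 0.3678795"
    by simp_all
  have "0 \<le> S" "0 \<le> E" using S E by simp_all
  hence "2.488206 * 0.3678794 \<le> S * E" "S * E \<le> 2.488207 * 0.3678795"
    by (intro mult_mono S E; simp)+
  moreover have "level_const = S * E"
    by (simp add: level_const_def S_def E_def exp_def field_simps scaleR_conv_of_real)
  ultimately show ?thesis unfolding abs_le_iff by simp
qed

section \<open>Averages over uniform subsets\<close>

definition ksubsets :: "nat \<Rightarrow> nat \<Rightarrow> nat set set" where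
  "ksubsets u m = {S. S \<subseteq> {..<u} \<and> card S = m}"

definition avg :: "nat \<Rightarrow> nat \<Rightarrow> (nat set \<Rightarrow> real) \<Rightarrow> real" where
  "avg u m F = (\<Sum>S\<in>ksubsets u m. F S) / real (u choose m)"

lemma finite_ksubsets [simp]: "finite (ksubsets u m)"
  by (rule finite_subset[of _ "Pow {..<u}"]) (auto simp: ksubsets_def)

lemma card_ksubsets: "card (ksubsets u m) = (u choose m)"
  using n_subsets[of "{..<u}" m] by (simp add: ksubsets_def)

lemma avg_sum: "avg u m (\<lambda>S. \<Sum>j\<in>J. F j S) = (\<Sum>j\<in>J. avg u m (F j))"
  by (simp add: avg_def sum.swap[of _ J] sum_divide_distrib)

lemma avg_cmult: "avg u m (\<lambda>S. c * F S) = c * avg u m F"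
  by (simp add: avg_def sum_distrib_left)

lemma avg_cong: "(\<And>S. S \<in> ksubsets u m \<Longrightarrow> F S = G S) \<Longrightarrow> avg u m F = avg u m G"
  by (simp add: avg_def)

lemma avg_diff_const_le:
  assumes "m \<le> u" and "\<And>S. S \<in> ksubsets u m \<Longrightarrow> \<bar>F S - (G S + c)\<bar> \<le> d"
  shows "\<bar>avg u m F - (avg u m G + c)\<bar> \<le> d"
proof -
  have pos: "real (u choose m) > 0" using assms by (simp add: zero_less_binomial)
  have "avg u m F - (avg u m G + c) = (\<Sum>S\<in>ksubsets u m. F S - (G S + c)) / real (u choose m)"
    using pos by (simp add: avg_def sum_subtractf sum.distrib card_ksubsets field_simps)
  also have "\<bar>\<dots>\<bar> \<le> (\<Sum>S\<in>ksubsets u m. d) / real (u choose m)"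
    unfolding abs_divide abs_of_nat using assms pos
    by (intro divide_right_mono order_trans[OF sum_abs] sum_mono) auto
  also have "\<dots> = d" using pos by (simp add: card_ksubsets)
  finally show ?thesis .
qed

text \<open>Removing \<open>T\<close> is a bijection onto the subsets of the complement of
  \<open>T\<close> with \<open>m - card T\<close> elements; adding \<open>T\<close> back is its
  inverse.\<close>

lemma card_supersets:
  assumes "T \<subseteq> {..<u}" "card T \<le> m"
  shows "card {S \<in> ksubsets u m. T \<subseteq> S} = (u - card T) choose (m - card T)"
proof -
  have fT: "finite T" using assms finite_subset by blast

  have "bij_betw (\<lambda>S. S - T) {S \<in> ksubsets u m. T \<subseteq> S} {R. R \<subseteq> {..<u} - T \<and> card R = m - card T}"
  proof (rule bij_betw_byWitness[where f' = "\<lambda>R. R \<union> T"])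
    show "(\<lambda>S. S - T) ` {S \<in> ksubsets u m. T \<subseteq> S} \<subseteq> {R. R \<subseteq> {..<u} - T \<and> card R = m - card T}"
    proof (rule image_subsetI)
      fix S assume "S \<in> {S \<in> ksubsets u m. T \<subseteq> S}"
      hence "S \<subseteq> {..<u}" "card S = m" "T \<subseteq> S" by (auto simp: ksubsets_def)
      thus "S - T \<in> {R. R \<subseteq> {..<u} - T \<and> card R = m - card T}"
        using fT by (simp add: card_Diff_subset Diff_mono)
    qed
    show "(\<lambda>R. R \<union> T) ` {R. R \<subseteq> {..<u} - T \<and> card R = m - card T} \<subseteq> {S \<in> ksubsets u m. T \<subseteq> S}"
    proof safe
      fix R assume R: "R \<subseteq> {..<u} - T" "card R = m - card T"
      hence "finite R" using finite_subset by blast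
      moreover have "R \<inter> T = {}" using R by auto
      ultimately have "card (R \<union> T) = m" using R fT assms by (simp add: card_Un_disjoint)
      thus "R \<union> T \<in> ksubsets u m" using R assms by (auto simp: ksubsets_def)
    qed
  qed auto
  hence "card {S \<in> ksubsets u m. T \<subseteq> S} = card {R. R \<subseteq> {..<u} - T \<and> card R = m - card T}"
    by (rule bij_betw_same_card)
  also have "\<dots> = card ({..<u} - T) choose (m - card T)" by (rule n_subsets) simp
  finally show ?thesis using assms fT by (simp add: card_Diff_subset)
qed

text \<open>Double counting: the binomial coefficient counts the \<open>k\<close>-subsets
  \<open>T\<close> of \<open>A\<close> that lie in \<open>S\<close>, and each \<open>T\<close> lies
  in \<open>(u - k) choose (m - k)\<close> of the sets \<open>S\<close>. For \<open>k > m\<close>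
  both sides are 0.\<close>

lemma avg_binomial_moment:
  assumes A: "A \<subseteq> {..<u}" and "m \<le> u"
  shows "avg u m (\<lambda>S. real (card (S \<inter> A) choose k)) =
    real (card A choose k) * real (m choose k) / real (u choose k)"
proof (cases "k \<le> m")
  case True
  have fA: "finite A" using A finite_subset by blast
  have "(\<Sum>S\<in>ksubsets u m. card (S \<inter> A) choose k)
      = (\<Sum>S\<in>ksubsets u m. \<Sum>T | T \<subseteq> A \<and> card T = k. if T \<subseteq> S then 1 else 0)"
  proof (intro sum.cong refl)
    fix S
    have "card (S \<inter> A) choose k = card {T. T \<subseteq> S \<inter> A \<and> card T = k}"
      using fA by (intro n_subsets[symmetric]) auto
    also have "{T. T \<subseteq> S \<inter> A \<and> card T = k} = {T \<in> {T. T \<subseteq> A \<and> card T = k}. T \<subseteq> S}" by auto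
    also have "card \<dots> = (\<Sum>T | T \<subseteq> A \<and> card T = k. if T \<subseteq> S then 1 else 0)"
      using fA by (subst sum.inter_filter[symmetric]) (auto intro: finite_subset[of _ "Pow A"])
    finally show "card (S \<inter> A) choose k = \<dots>" .
  qed
  also have "\<dots> = (\<Sum>T | T \<subseteq> A \<and> card T = k. card {S \<in> ksubsets u m. T \<subseteq> S})"
    by (subst sum.swap) (simp flip: sum.inter_filter)
  also have "\<dots> = (\<Sum>T | T \<subseteq> A \<and> card T = k. (u - k) choose (m - k))"
    using A True by (intro sum.cong refl) (auto simp: card_supersets)
  also have "\<dots> = (card A choose k) * ((u - k) choose (m - k))"
    using fA by (simp add: n_subsets)
  finally have "(\<Sum>S\<in>ksubsets u m. real (card (S \<inter> A) choose k))
      = real (card A choose k) * real ((u - k) choose (m - k))"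
    by (simp flip: of_nat_sum of_nat_mult)
  \<comment> \<open>Trinomial revision replaces the count of supersets by the quotient in the
    claim.\<close>
  moreover have "real (u choose m) * real (m choose k) = real (u choose k) * real ((u - k) choose (m - k))"
    using choose_mult[of k m u] True assms by (simp flip: of_nat_mult)
  moreover have "real (u choose m) > 0" "real (u choose k) > 0" using True assms by (auto simp: zero_less_binomial)
  ultimately show ?thesis by (simp add: avg_def field_simps)
next
  case False
  hence "card (S \<inter> A) choose k = 0" if "S \<in> ksubsets u m" for S
  proof -
    have "finite S" using that finite_subset by (auto simp: ksubsets_def)
    hence "card (S \<inter> A) \<le> m" using that by (auto simp: ksubsets_def intro: card_mono)
    thus ?thesis using False by (simp add: binomial_eq_0)
  qed
  thus ?thesis using False by (simp add: avg_def binomial_eq_0)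
qed

text \<open>The Newton expansion can be cut at \<open>m\<close> for every \<open>S\<close> at once,
  since intersections have at most \<open>m\<close> elements. Linearity then gives the binomial
  moments, and the series is finite because \<open>m choose k\<close> vanishes beyond
  \<open>m\<close>.\<close>

lemma avg_eq_hyp_series:
  assumes A: "A \<subseteq> {..<u}" and "m \<le> u"
  shows "avg u m (\<lambda>S. h (card (S \<inter> A))) = hyp_series h u (card A) m"
proof -
  have "avg u m (\<lambda>S. h (card (S \<inter> A)))
      = avg u m (\<lambda>S. \<Sum>k\<le>m. newton_coeff h k * real (card (S \<inter> A) choose k))"
  proof (rule avg_cong)
    fix S assume S: "S \<in> ksubsets u m"
    hence "finite S" using finite_subset by (auto simp: ksubsets_def)
    hence "card (S \<inter> A) \<le> m" using S by (auto simp: ksubsets_def intro: card_mono)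
    thus "h (card (S \<inter> A)) = (\<Sum>k\<le>m. newton_coeff h k * real (card (S \<inter> A) choose k))"
      unfolding newton_expansion[of h "card (S \<inter> A)"]
      by (intro sum.mono_neutral_left) (auto simp: binomial_eq_0)
  qed
  also have "\<dots> = (\<Sum>k\<le>m. newton_coeff h k * (real (card A choose k) * real (m choose k) / real (u choose k)))"
    by (simp only: avg_sum avg_cmult avg_binomial_moment[OF assms])
  also have "\<dots> = hyp_series h u (card A) m"
    unfolding hyp_series_def by (rule suminf_finite[symmetric]) (auto simp: binomial_eq_0)
  finally show ?thesis .
qed

section \<open>Exchangeable random sets\<close>

text \<open>Conditioning on the cardinality, done as a double sum over pairs of subsets of equal
  size.\<close>

lemma expectation_exchangeable:
  assumes D: "set_pmf D \<subseteq> Pow {..<u}"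
    and ex: "\<And>S S'. S \<subseteq> {..<u} \<Longrightarrow> S' \<subseteq> {..<u} \<Longrightarrow> card S = card S' \<Longrightarrow> pmf D S = pmf D S'"
  shows "measure_pmf.expectation D F = measure_pmf.expectation D (\<lambda>S. avg u (card S) F)"
proof -
  let ?P = "Pow {..<u}"
  have E: "measure_pmf.expectation D G = (\<Sum>S\<in>?P. G S * pmf D S)" for G :: "nat set \<Rightarrow> real"
    using D by (intro integral_measure_pmf_real) auto
  have "(\<Sum>S\<in>?P. avg u (card S) F * pmf D S)
      = (\<Sum>S\<in>?P. \<Sum>S'\<in>?P. if card S' = card S then F S' * (pmf D S / real (u choose card S)) else 0)"
  proof (intro sum.cong refl)
    fix S assume "S \<in> ?P"
    have "ksubsets u (card S) = {S' \<in> ?P. card S' = card S}" by (auto simp: ksubsets_def)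
    thus "avg u (card S) F * pmf D S
        = (\<Sum>S'\<in>?P. if card S' = card S then F S' * (pmf D S / real (u choose card S)) else 0)"
      by (simp add: avg_def sum_distrib_right sum_divide_distrib flip: sum.inter_filter)
  qed
  \<comment> \<open>Exchangeability allows \<open>pmf D S'\<close> in place of
    \<open>pmf D S\<close>; the inner summand then no longer depends on \<open>S\<close>, and the
    number of its occurrences cancels the normalisation.\<close>
  also have "\<dots> = (\<Sum>S'\<in>?P. \<Sum>S\<in>?P. if card S = card S' then F S' * (pmf D S' / real (u choose card S')) else 0)"
    by (subst sum.swap) (intro sum.cong refl, auto dest: ex)
  also have "\<dots> = (\<Sum>S'\<in>?P. F S' * pmf D S')"
  proof (intro sum.cong refl)
    fix S' assume S': "S' \<in> ?P"
    hence "card S' \<le> u" using card_mono[of "{..<u}" S'] by auto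
    hence pos: "u choose card S' > 0" by (simp add: zero_less_binomial)
    have "{S \<in> ?P. card S = card S'} = ksubsets u (card S')" by (auto simp: ksubsets_def)
    thus "(\<Sum>S\<in>?P. if card S = card S' then F S' * (pmf D S' / real (u choose card S')) else 0) = F S' * pmf D S'"
      using pos by (simp add: card_ksubsets flip: sum.inter_filter)
  qed
  finally show ?thesis by (simp only: E)
qed

section \<open>Draws and the two models of key sets\<close>

definition draws :: "nat \<Rightarrow> nat \<Rightarrow> (nat \<Rightarrow> nat) set" where
  "draws u n = PiE_dflt {..<n} 0 (\<lambda>_. {..<u})"

lemma finite_draws: "finite (draws u n)"
  by (auto simp: draws_def)

lemma iid_draws_eq: "u > 0 \<Longrightarrow> iid_draws u n = pmf_of_set (draws u n)"
  unfolding iid_draws_def draws_def by (rule Pi_pmf_of_set) auto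

lemma draws_nonempty: "u > 0 \<Longrightarrow> draws u n \<noteq> {}"
  by (auto simp: draws_def)

text \<open>Guarantees that conditioning on distinct draws is meaningful.\<close>

lemma inj_draw_exists: "n \<le> u \<Longrightarrow> \<exists>X \<in> draws u n. inj_on X {..<n}"
  by (rule bexI[of _ "\<lambda>i. if i < n then i else 0"]) (auto simp: draws_def PiE_dflt_def inj_on_def)

text \<open>Composing a draw with a bijection from \<open>S\<close> to \<open>S'\<close> moves its
  range and preserves injectivity. One inequality suffices, since the roles of \<open>S\<close> and
  \<open>S'\<close> can be swapped.\<close>

lemma card_draws_with_range_le:
  assumes "S \<subseteq> {..<u}" "S' \<subseteq> {..<u}" "card S = card S'"
  shows "card {X \<in> draws u n. (I \<longrightarrow> inj_on X {..<n}) \<and> X ` {..<n} = S}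
       \<le> card {X \<in> draws u n. (I \<longrightarrow> inj_on X {..<n}) \<and> X ` {..<n} = S'}"
proof -
  obtain \<sigma> where \<sigma>: "bij_betw \<sigma> S S'"
    using assms finite_same_card_bij[of S S'] finite_subset by blast
  \<comment> \<open>The value 0 from \<open>n\<close> onwards is the default demanded by
    \<open>draws\<close>; it also makes the map injective on whole functions.\<close>
  define \<Phi> where "\<Phi> X = (\<lambda>i. if i < n then \<sigma> (X i) else 0)" for X :: "nat \<Rightarrow> nat"
  show ?thesis
  proof (rule card_inj_on_le[of \<Phi>])
    show "inj_on \<Phi> {X \<in> draws u n. (I \<longrightarrow> inj_on X {..<n}) \<and> X ` {..<n} = S}"
    proof (rule inj_onI, rule ext)
      fix X Y i assume X: "X \<in> {X \<in> draws u n. (I \<longrightarrow> inj_on X {..<n}) \<and> X ` {..<n} = S}"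
        and Y: "Y \<in> {X \<in> draws u n. (I \<longrightarrow> inj_on X {..<n}) \<and> X ` {..<n} = S}" and eq: "\<Phi> X = \<Phi> Y"
      show "X i = Y i"
      proof (cases "i < n")
        case True
        hence "\<sigma> (X i) = \<sigma> (Y i)" using fun_cong[OF eq, of i] by (simp add: \<Phi>_def)
        moreover have "X i \<in> S" "Y i \<in> S" using X Y True by auto
        ultimately show ?thesis using \<sigma> by (auto simp: bij_betw_def inj_on_def)
      qed (use X Y in \<open>auto simp: draws_def PiE_dflt_def\<close>)
    qed
    show "\<Phi> ` {X \<in> draws u n. (I \<longrightarrow> inj_on X {..<n}) \<and> X ` {..<n} = S}
        \<subseteq> {X \<in> draws u n. (I \<longrightarrow> inj_on X {..<n}) \<and> X ` {..<n} = S'}"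
    proof (rule image_subsetI)
      fix X assume "X \<in> {X \<in> draws u n. (I \<longrightarrow> inj_on X {..<n}) \<and> X ` {..<n} = S}"
      hence X: "X \<in> draws u n" "I \<longrightarrow> inj_on X {..<n}" "S = X ` {..<n}" by auto
      have im: "\<Phi> X ` {..<n} = \<sigma> ` (X ` {..<n})" by (auto simp: \<Phi>_def image_image)
      hence im': "\<Phi> X ` {..<n} = S'" using \<sigma> X by (simp add: bij_betw_def)
      have "\<Phi> X \<in> draws u n"
        using im' assms(2) by (auto simp: draws_def PiE_dflt_def \<Phi>_def)
      moreover have "inj_on (\<Phi> X) {..<n}" if I
      proof -
        have "inj_on (\<sigma> \<circ> X) {..<n}"
          using X that \<sigma> by (intro comp_inj_on) (auto simp: bij_betw_def)
        thus ?thesis by (rule inj_on_cong[THEN iffD1, rotated]) (auto simp: \<Phi>_def)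
      qed
      ultimately show "\<Phi> X \<in> {X \<in> draws u n. (I \<longrightarrow> inj_on X {..<n}) \<and> X ` {..<n} = S'}"
        using im' by simp
    qed
  qed (simp add: finite_draws)
qed

text \<open>The flag \<open>I\<close> switches between the draws conditioned on distinctness and all draws.\<close>

lemma key_set_exchangeable:
  fixes I :: bool and u n :: nat
  defines "\<Omega> \<equiv> {X \<in> draws u n. I \<longrightarrow> inj_on X {..<n}}"
  defines "D \<equiv> map_pmf (\<lambda>X. X ` {..<n}) (pmf_of_set \<Omega>)"
  assumes "\<Omega> \<noteq> {}"
  shows "set_pmf D \<subseteq> Pow {..<u}"
    and "S \<subseteq> {..<u} \<Longrightarrow> S' \<subseteq> {..<u} \<Longrightarrow> card S = card S' \<Longrightarrow> pmf D S = pmf D S'"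
proof -
  have fin: "finite \<Omega>" by (simp add: \<Omega>_def finite_draws)
  show "set_pmf D \<subseteq> Pow {..<u}"
    using fin \<open>\<Omega> \<noteq> {}\<close> by (auto simp: D_def \<Omega>_def draws_def PiE_dflt_def)
  have pmf: "pmf D S = card {X \<in> draws u n. (I \<longrightarrow> inj_on X {..<n}) \<and> X ` {..<n} = S} / card \<Omega>" for S
  proof -
    have "\<Omega> \<inter> (\<lambda>X. X ` {..<n}) -` {S} = {X \<in> draws u n. (I \<longrightarrow> inj_on X {..<n}) \<and> X ` {..<n} = S}"
      by (auto simp: \<Omega>_def)
    thus ?thesis using fin \<open>\<Omega> \<noteq> {}\<close> by (simp add: D_def pmf_map measure_pmf_of_set)
  qed
  assume "S \<subseteq> {..<u}" "S' \<subseteq> {..<u}" "card S = card S'"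
  thus "pmf D S = pmf D S'"
    unfolding pmf using card_draws_with_range_le[of S u S' n I] card_draws_with_range_le[of S' u S n I] by simp
qed

text \<open>The vacuous premise \<open>False\<close> gives this model the same shape as the distinct
  one, so that a single flag covers both.\<close>

lemma merged_key_set_eq:
  "u > 0 \<Longrightarrow> merged_key_set u n = map_pmf (\<lambda>X. X ` {..<n}) (pmf_of_set {X \<in> draws u n. False \<longrightarrow> inj_on X {..<n}})"
  by (simp add: merged_key_set_def iid_draws_eq)

lemma cond_pmf_of_set:
  assumes "finite A" "A \<inter> B \<noteq> {}"
  shows "cond_pmf (pmf_of_set A) B = pmf_of_set (A \<inter> B)"
proof (rule pmf_eqI)
  fix x
  have ne: "A \<noteq> {}" using assms by auto
  hence ne': "set_pmf (pmf_of_set A) \<inter> B \<noteq> {}" using assms by simp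
  have "card A > 0" "card (A \<inter> B) > 0" using assms ne by (auto simp: card_gt_0_iff)
  thus "pmf (cond_pmf (pmf_of_set A) B) x = pmf (pmf_of_set (A \<inter> B)) x"
    using assms ne by (simp add: pmf_cond[OF ne'] measure_pmf_of_set indicator_def)
qed

lemma distinct_key_set_eq:
  assumes "u > 0" "n \<le> u"
  shows "distinct_key_set u n = map_pmf (\<lambda>X. X ` {..<n}) (pmf_of_set {X \<in> draws u n. True \<longrightarrow> inj_on X {..<n}})"
proof -
  have "draws u n \<inter> {X. inj_on X {..<n}} \<noteq> {}" using inj_draw_exists[OF assms(2)] by auto
  moreover have "{X \<in> draws u n. True \<longrightarrow> inj_on X {..<n}} = draws u n \<inter> {X. inj_on X {..<n}}" by auto
  ultimately show ?thesis
    using assms by (simp add: distinct_key_set_def iid_draws_eq cond_pmf_of_set finite_draws draws_nonempty)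
qed

lemma key_set_expectation:
  assumes "0 < u" "n \<le> u" "\<D> \<in> {distinct_key_set, merged_key_set}"
  shows "set_pmf (\<D> u n) \<subseteq> {S. S \<subseteq> {..<u} \<and> card S \<le> n}"
    and "measure_pmf.expectation (\<D> u n) F = measure_pmf.expectation (\<D> u n) (\<lambda>S. avg u (card S) F)"
proof -
  obtain I where eq: "\<D> u n = map_pmf (\<lambda>X. X ` {..<n}) (pmf_of_set {X \<in> draws u n. I \<longrightarrow> inj_on X {..<n}})"
    using assms(3) distinct_key_set_eq[OF assms(1,2)] merged_key_set_eq[OF assms(1), of n] by blast
  have ne: "{X \<in> draws u n. I \<longrightarrow> inj_on X {..<n}} \<noteq> {}" using inj_draw_exists[OF assms(2)] by auto
  have "finite {X \<in> draws u n. I \<longrightarrow> inj_on X {..<n}}" by (simp add: finite_draws)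
  thus "set_pmf (\<D> u n) \<subseteq> {S. S \<subseteq> {..<u} \<and> card S \<le> n}"
    using key_set_exchangeable(1)[OF ne] ne unfolding eq by (auto intro: order_trans[OF card_image_le])
  show "measure_pmf.expectation (\<D> u n) F = measure_pmf.expectation (\<D> u n) (\<lambda>S. avg u (card S) F)"
    unfolding eq
    by (rule expectation_exchangeable, rule key_set_exchangeable(1)[OF ne], rule key_set_exchangeable(2)[OF ne])
qed

section \<open>The expected number of distinct keys\<close>

text \<open>By linearity the expectation is \<open>u\<close> times the probability that a fixed
  element is drawn, \<open>1 - (1 - 1 / u) ^ n\<close>, which is then expanded to second
  order.\<close>

lemma merged_card_expectation_ge:
  assumes u: "0 < u"
  shows "measure_pmf.expectation (merged_key_set u n) (\<lambda>S. real (card S)) \<ge> real n - real n ^ 2 / real u"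
proof -
  let ?D = "merged_key_set u n"
  have D: "set_pmf ?D \<subseteq> Pow {..<u}"
    using u by (auto simp: merged_key_set_def iid_draws_eq finite_draws draws_nonempty)
      (auto simp: draws_def PiE_dflt_def)
  have P: "measure ?D {S. x \<in> S} = 1 - (1 - 1 / real u) ^ n" if "x < u" for x
  proof -
    have "measure ?D {S. x \<notin> S} = measure (iid_draws u n) (Pi {..<n} (\<lambda>_. - {x}))"
      by (simp add: merged_key_set_def) (rule arg_cong[of _ _ "measure _"], auto)
    also have "\<dots> = (\<Prod>i<n. measure (pmf_of_set {..<u}) (- {x}))"
      unfolding iid_draws_def by (rule measure_Pi_pmf_Pi) simp
    also have "measure (pmf_of_set {..<u}) (- {x}) = 1 - 1 / real u"
    proof -
      have "{..<u} \<inter> - {x} = {..<u} - {x}" by auto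
      hence "measure (pmf_of_set {..<u}) (- {x}) = real (u - 1) / real u"
        using that u by (subst measure_pmf_of_set) auto
      thus ?thesis using u by (simp add: of_nat_diff field_simps)
    qed
    finally have "measure ?D {S. x \<notin> S} = (1 - 1 / real u) ^ n" by simp
    moreover have "measure ?D {S. x \<in> S} = 1 - measure ?D {S. x \<notin> S}"
      using measure_pmf.prob_compl[of "{S. x \<notin> S}" ?D] by (simp add: Compl_eq_Diff_UNIV[symmetric] Collect_neg_eq[symmetric])
    ultimately show ?thesis by simp
  qed
  have "measure_pmf.expectation ?D (\<lambda>S. real (card S)) = (\<Sum>S\<in>Pow {..<u}. real (card S) * pmf ?D S)"
    using D by (intro integral_measure_pmf_real) auto
  also have "\<dots> = (\<Sum>S\<in>Pow {..<u}. \<Sum>x<u. if x \<in> S then pmf ?D S else 0)"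
  proof (intro sum.cong refl)
    fix S assume "S \<in> Pow {..<u}"
    hence "{x \<in> {..<u}. x \<in> S} = S" by auto
    thus "real (card S) * pmf ?D S = (\<Sum>x<u. if x \<in> S then pmf ?D S else 0)"
      by (simp flip: sum.inter_filter)
  qed
  also have "\<dots> = (\<Sum>x<u. \<Sum>S\<in>Pow {..<u}. if x \<in> S then pmf ?D S else 0)" by (rule sum.swap)
  also have "\<dots> = (\<Sum>x<u. 1 - (1 - 1 / real u) ^ n)"
  proof (intro sum.cong refl)
    fix x assume "x \<in> {..<u}"
    have "(\<Sum>S\<in>Pow {..<u}. if x \<in> S then pmf ?D S else 0) = (\<Sum>S | S \<in> Pow {..<u} \<and> x \<in> S. pmf ?D S)"
      by (rule sum.inter_filter[symmetric]) simp
    also have "\<dots> = measure ?D {S. S \<in> Pow {..<u} \<and> x \<in> S}"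
      by (rule measure_measure_pmf_finite[symmetric]) simp
    also have "\<dots> = measure ?D {S. x \<in> S}"
      using D by (intro measure_pmf.finite_measure_eq_AE) (auto simp: AE_measure_pmf_iff)
    finally show "(\<Sum>S\<in>Pow {..<u}. if x \<in> S then pmf ?D S else 0) = 1 - (1 - 1 / real u) ^ n"
      using P \<open>x \<in> {..<u}\<close> by simp
  qed
  also have "\<dots> = real u * (1 - (1 - 1 / real u) ^ n)" by simp
  also have "\<dots> \<ge> real n - real n ^ 2 / real u"
  proof -
    define q where "q = 1 / real u"
    have q: "0 < q" "q \<le> 1" using u by (auto simp: q_def)
    \<comment> \<open>Bernoulli's inequality together with \<open>(1 - q) * (1 + q) \<le> 1\<close>
      bounds \<open>(1 - q) ^ n\<close> by \<open>1 / (1 + n * q)\<close>.\<close>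
    have "(1 - q) ^ n * (1 + real n * q) \<le> (1 - q) ^ n * (1 + q) ^ n"
      using q by (intro mult_left_mono Bernoulli_inequality) auto
    also have "\<dots> = (1 - q ^ 2) ^ n" by (simp add: power2_eq_square algebra_simps flip: power_mult_distrib)
    also have "\<dots> \<le> 1" using q by (intro power_le_one) (auto simp: power_le_one)
    finally have "(1 - q) ^ n \<le> 1 / (1 + real n * q)"
      using q by (simp add: pos_le_divide_eq add_pos_nonneg)
    \<comment> \<open>With \<open>y = n * q\<close> this rests on
      \<open>(1 - y + y ^ 2) * (1 + y) = 1 + y ^ 3\<close>.\<close>
    also have "\<dots> \<le> 1 - real n * q + (real n * q) ^ 2"
    proof -
      have "0 \<le> (real n * q) ^ 3" using q by simp
      hence "1 \<le> (1 - real n * q + (real n * q) ^ 2) * (1 + real n * q)"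
        by (simp add: power2_eq_square power3_eq_cube algebra_simps)
      thus ?thesis using q by (simp add: pos_divide_le_eq add_pos_nonneg)
    qed
    finally have "real u * (1 - (1 - q) ^ n) \<ge> real u * (real n * q - (real n * q) ^ 2)"
      by (intro mult_left_mono) auto
    moreover have "real u * (real n * q - (real n * q) ^ 2) = real n - real n ^ 2 / real u"
      using u by (simp add: q_def power2_eq_square field_simps)
    ultimately show ?thesis by (simp add: q_def)
  qed
  finally show ?thesis .
qed

lemma key_set_card_expectation_ge:
  assumes "0 < u" "n \<le> u" "\<D> \<in> {distinct_key_set, merged_key_set}"
  shows "measure_pmf.expectation (\<D> u n) (\<lambda>S. real (card S)) \<ge> real n - real n ^ 2 / real u"
proof (cases "\<D> = merged_key_set")
  case False
  have ne: "draws u n \<inter> {X. inj_on X {..<n}} \<noteq> {}" using inj_draw_exists[OF assms(2)] by auto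
  have "card S = n" if "S \<in> set_pmf (distinct_key_set u n)" for S
    using that ne assms distinct_key_set_eq[of u n] finite_draws[of u n]
    by (auto simp: Collect_conj_eq card_image set_pmf_of_set)
  hence "measure_pmf.expectation (distinct_key_set u n) (\<lambda>S. real (card S))
      = measure_pmf.expectation (distinct_key_set u n) (\<lambda>_. real n)"
    by (intro integral_cong_AE) (auto simp: AE_measure_pmf_iff)
  thus ?thesis using False assms by simp
qed (use merged_card_expectation_ge assms in simp)

section \<open>Bucket offsets and queries\<close>

lemma linear_mapper_eq_div: "linear_mapper u n x = x * n div u"
  unfolding linear_mapper_def by (metis floor_divide_of_nat_eq nat_int of_nat_mult)

lemma linear_mapper_mono: "x \<le> y \<Longrightarrow> linear_mapper u n x \<le> linear_mapper u n y"
  by (simp add: linear_mapper_eq_div div_le_mono)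

lemma linear_mapper_less: "x < u \<Longrightarrow> n > 0 \<Longrightarrow> linear_mapper u n x < n"
  by (simp add: linear_mapper_eq_div less_mult_imp_div_less mult.commute)

lemma sum_card_bucket:
  assumes "finite S"
  shows "(\<Sum>j<i. card (bucket \<beta> S j)) = card {x \<in> S. \<beta> x < i}"
proof -
  have "{x \<in> S. \<beta> x < i} = (\<Union>j<i. bucket \<beta> S j)" by (auto simp: bucket_def)
  thus ?thesis using assms by (simp add: card_UN_disjoint bucket_def disjoint_iff)
qed

lemma bucket_offsets_nth:
  "finite S \<Longrightarrow> i \<le> card S \<Longrightarrow> bucket_offsets \<beta> S ! i = card {x \<in> S. \<beta> x < i}"
  by (simp add: bucket_offsets_def sum_card_bucket del: upt_Suc)

lemma length_bucket_offsets [simp]: "length (bucket_offsets \<beta> S) = card S + 1"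
  by (simp add: bucket_offsets_def)

lemma bucket_offsets_nth_le: "finite S \<Longrightarrow> i \<le> card S \<Longrightarrow> bucket_offsets \<beta> S ! i \<le> card S"
  by (simp add: bucket_offsets_nth card_mono)

lemma sorted_bucket_offsets: "finite S \<Longrightarrow> sorted (bucket_offsets \<beta> S)"
  by (auto simp: sorted_iff_nth_mono less_Suc_eq_le bucket_offsets_nth intro!: card_mono)

lemma length_ef_encode [simp]: "length (ef_encode vmax vs) = vmax + length vs"
  by (simp add: ef_encode_def)

text \<open>Adding the index makes a non-decreasing sequence strictly increasing, so distinct
  entries occupy distinct positions. Both lists are then sorted and distinct with the same elements,
  hence equal.\<close>

lemma ef_encode_ones:
  assumes "sorted vs" "\<forall>v\<in>set vs. v \<le> vmax"
  shows "filter (\<lambda>p. ef_encode vmax vs ! p) [0..<length (ef_encode vmax vs)]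
       = map (\<lambda>i. vs ! i + i) [0..<length vs]"
proof (rule sorted_distinct_set_unique)
  have *: "vs ! i + i < vs ! j + j" if "i < j" "j < length vs" for i j
    using sorted_nth_mono[OF assms(1), of i j] that by simp
  show "sorted (map (\<lambda>i. vs ! i + i) [0..<length vs])"
    unfolding sorted_iff_nth_mono_less using * by (auto intro: less_imp_le)
  show "distinct (map (\<lambda>i. vs ! i + i) [0..<length vs])"
    using * by (auto simp: distinct_map inj_on_def) (metis less_irrefl linorder_neqE_nat)
  have "vs ! i + i < vmax + length vs" if "i < length vs" for i
    using assms(2) nth_mem[OF that] that by (meson add_le_less_mono)
  thus "set (filter (\<lambda>p. ef_encode vmax vs ! p) [0..<length (ef_encode vmax vs)])
      = set (map (\<lambda>i. vs ! i + i) [0..<length vs])"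
    by (auto simp: ef_encode_def)
qed (auto simp: sorted_wrt_filter)

lemma select1_ef_encode:
  assumes "sorted vs" "\<forall>v\<in>set vs. v \<le> vmax" "j < length vs"
  shows "select1 (ef_encode vmax vs) j = vs ! j + j"
  unfolding select1_def ef_encode_ones[OF assms(1,2)] using assms(3) by simp

lemma count_list_ef_encode:
  assumes "sorted vs" "\<forall>v\<in>set vs. v \<le> vmax"
  shows "count_list (ef_encode vmax vs) True = length vs"
proof -
  have "count_list B True = length (filter (\<lambda>p. B ! p) [0..<length B])" for B
  proof -
    have "count_list B True = length (filter (\<lambda>b. b) (map ((!) B) [0..<length B]))"
      by (simp add: map_nth count_list_eq_length_filter eq_True[abs_def] cong: filter_cong)
    thus ?thesis by (simp add: filter_map comp_def)
  qed
  thus ?thesis using ef_encode_ones[OF assms] by simp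
qed

section \<open>Word arithmetic and the correctness of queries\<close>

lemma w_sub_eq:
  assumes "y \<le> x" "x < 2 ^ w"
  shows "w_sub w x y = (x - y, 1)"
proof -
  have "x + (2 ^ w - y) = (x - y) + 2 ^ w" using assms by simp
  thus ?thesis using assms by (simp only: w_sub_def mod_add_self2) simp
qed

text \<open>Select returns the offset plus \<open>j\<close>. This is at most
  \<open>2 * card S\<close>, so under the size assumption the subtraction of \<open>j\<close>
  happens without wrap-around.\<close>

lemma ef_access_bucket_offsets:
  assumes "finite S" "2 * card S < 2 ^ w" "j \<le> card S"
    and sel: "\<And>j. j \<le> card S \<Longrightarrow> fst (sel_query I w B s j) = bucket_offsets \<beta> S ! j + j \<and>
                snd (sel_query I w B s j) \<le> t"
  obtains t' where "ef_access I w B s j = (card {x \<in> S. \<beta> x < j}, t')" "t' \<le> t + 1"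
proof -
  obtain t1 where q: "sel_query I w B s j = (bucket_offsets \<beta> S ! j + j, t1)" "t1 \<le> t"
    using sel[OF assms(3)] by (metis prod.collapse)
  have "bucket_offsets \<beta> S ! j + j < 2 ^ w"
    using bucket_offsets_nth_le[OF assms(1,3), of \<beta>] assms by linarith
  hence "ef_access I w B s j = (bucket_offsets \<beta> S ! j, t1 + 1)"
    by (simp add: ef_access_def bind_timed_def q w_sub_eq)
  thus thesis using that bucket_offsets_nth[OF assms(1,3)] q(2) by simp
qed

text \<open>By monotonicity of the mapper, a key below \<open>q\<close> lies in an earlier bucket or
  below \<open>q\<close> in the same bucket.\<close>

lemma key_rank_split:
  assumes "finite S" "mono \<beta>" "q \<in> S"
  shows "key_rank S q = card {x \<in> S. \<beta> x < \<beta> q} + local_rank \<beta> S q"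
proof -
  have "{y \<in> S. y < q} = {x \<in> S. \<beta> x < \<beta> q} \<union> {y \<in> bucket \<beta> S (\<beta> q). y < q}"
    using \<open>mono \<beta>\<close> by (auto simp: bucket_def mono_def) (metis le_less_linear less_le_not_le order.order_iff_strict)+
  moreover have "{x \<in> S. \<beta> x < \<beta> q} \<inter> {y \<in> bucket \<beta> S (\<beta> q). y < q} = {}"
    by (auto simp: bucket_def)
  ultimately show ?thesis
    using assms by (simp add: key_rank_def local_rank_def card_Un_disjoint bucket_def)
qed

lemma local_rank_less:
  assumes "finite S" "q \<in> S"
  shows "local_rank \<beta> S q < card (bucket \<beta> S (\<beta> q))"
  unfolding local_rank_def key_rank_def using assms
  by (intro psubset_card_mono) (auto simp: bucket_def)

text \<open>The preconditions of the retrieval assumption, for every level that exists. Local ranks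
  fit because they are below the bucket size, which is at most \<open>2 ^ i\<close>.\<close>

lemma level_keys_retrievable:
  assumes "S \<subseteq> {..<2 ^ w}" "i \<le> clog2 (card S)"
  shows "level_keys \<beta> S i \<subseteq> {..<2 ^ w}" and "i \<le> w"
    and "\<forall>x\<in>level_keys \<beta> S i. local_rank \<beta> S x < 2 ^ i"
proof -
  have fin: "finite S" using assms(1) finite_subset by blast
  have "card S \<le> 2 ^ w" using card_mono[OF _ assms(1)] by simp
  thus "i \<le> w" using assms(2) clog2_le_iff order_trans by blast
  show "level_keys \<beta> S i \<subseteq> {..<2 ^ w}" using assms(1) by (auto simp: level_keys_def)
  show "\<forall>x\<in>level_keys \<beta> S i. local_rank \<beta> S x < 2 ^ i"
    using local_rank_less[OF fin] le_two_power_clog2 by (fastforce simp: level_keys_def intro: order_less_le_trans)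
qed

lemma select_structureE:
  assumes "select_structure I"
  obtains g t where "g \<in> o(\<lambda>N. real N)"
    and "\<And>w B. length B \<le> 2 ^ w \<Longrightarrow> real (sel_bits I (sel_build I w B)) \<le> g (length B)"
    and "\<And>w B j. length B \<le> 2 ^ w \<Longrightarrow> j < count_list B True \<Longrightarrow>
      fst (sel_query I w B (sel_build I w B) j) = select1 B j \<and> snd (sel_query I w B (sel_build I w B) j) \<le> t"
proof -
  obtain g t where g: "g \<in> o(\<lambda>N. real N)" and all: "\<forall>w B. length B \<le> 2 ^ w \<longrightarrow>
      real (sel_bits I (sel_build I w B)) \<le> g (length B) \<and>
      (\<forall>j < count_list B True.
         fst (sel_query I w B (sel_build I w B) j) = select1 B j \<and>
         snd (sel_query I w B (sel_build I w B) j) \<le> t)"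
    using assms unfolding select_structure_def by (elim exE conjE)
  show thesis
    by (rule that[OF g]) (use all in blast)+
qed

lemma retrieval_structureE:
  assumes "retrieval_structure J"
  obtains g t where "g \<in> o(\<lambda>n. real n)"
    and "\<And>w r K f. K \<subseteq> {..<2 ^ w} \<Longrightarrow> r \<le> w \<Longrightarrow> \<forall>x\<in>K. f x < 2 ^ r \<Longrightarrow>
      \<bar>real (ret_bits J (ret_build J w r K f)) - real (r * card K)\<bar> \<le> g (card K)"
    and "\<And>w r K f x. K \<subseteq> {..<2 ^ w} \<Longrightarrow> r \<le> w \<Longrightarrow> \<forall>x\<in>K. f x < 2 ^ r \<Longrightarrow> x \<in> K \<Longrightarrow>
      fst (ret_query J w (ret_build J w r K f) x) = f x \<and> snd (ret_query J w (ret_build J w r K f) x) \<le> t"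
proof -
  obtain g t where g: "g \<in> o(\<lambda>n'. real n')" and all: "\<forall>w r K f.
      K \<subseteq> {..<2 ^ w} \<and> r \<le> w \<and> (\<forall>x\<in>K. f x < 2 ^ r) \<longrightarrow>
      \<bar>real (ret_bits J (ret_build J w r K f)) - real (r * card K)\<bar> \<le> g (card K) \<and>
      (\<forall>x\<in>K. fst (ret_query J w (ret_build J w r K f) x) = f x \<and>
             snd (ret_query J w (ret_build J w r K f) x) \<le> t)"
    using assms unfolding retrieval_structure_def by (elim exE conjE)
  show thesis
  proof (rule that[OF g])
    fix w r :: nat and f :: "nat \<Rightarrow> nat" and K :: "nat set"
    assume K: "K \<subseteq> {..<2 ^ w}" "r \<le> w" "\<forall>x\<in>K. f x < 2 ^ r"
    from all K show "\<bar>real (ret_bits J (ret_build J w r K f)) - real (r * card K)\<bar> \<le> g (card K)"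
      by blast
    fix x assume "x \<in> K"
    with all K show "fst (ret_query J w (ret_build J w r K f) x) = f x \<and>
        snd (ret_query J w (ret_build J w r K f) x) \<le> t"
      by blast
  qed
qed

lemma lemonhash_query_correct:
  assumes "select_structure I" and "retrieval_structure J"
  shows "\<exists>t. \<forall>w S q. S \<subseteq> {..<2 ^ w} \<and> 2 * card S < 2 ^ w \<and> q \<in> S \<longrightarrow>
            fst (lemonhash_query I J w (lemonhash_build I J w S) q) = key_rank S q \<and>
            snd (lemonhash_query I J w (lemonhash_build I J w S) q) \<le> t"
proof -
  obtain t1 where t1: "\<And>w B j. length B \<le> 2 ^ w \<Longrightarrow> j < count_list B True \<Longrightarrow>
      fst (sel_query I w B (sel_build I w B) j) = select1 B j \<and> snd (sel_query I w B (sel_build I w B) j) \<le> t1"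
    using select_structureE[OF assms(1)] by metis
  obtain t2 where t2: "\<And>w r K f x. K \<subseteq> {..<2 ^ w} \<Longrightarrow> r \<le> w \<Longrightarrow> \<forall>x\<in>K. f x < 2 ^ r \<Longrightarrow> x \<in> K \<Longrightarrow>
      fst (ret_query J w (ret_build J w r K f) x) = f x \<and> snd (ret_query J w (ret_build J w r K f) x) \<le> t2"
    using retrieval_structureE[OF assms(2)] by metis
  \<comment> \<open>The bound counts two select queries, one retrieval query and the 12 unit steps
    of the longer branch, two of which are the subtractions inside \<open>ef_access\<close>.\<close>
  have "fst (lemonhash_query I J w (lemonhash_build I J w S) q) = key_rank S q \<and>
        snd (lemonhash_query I J w (lemonhash_build I J w S) q) \<le> 2 * t1 + t2 + 12"
    if S: "S \<subseteq> {..<2 ^ w}" and small: "2 * card S < 2 ^ w" and q: "q \<in> S" for w S q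
  proof -
    define n where "n = card S"
    define \<beta> where "\<beta> = linear_mapper (2 ^ w) n"
    define B where "B = ef_encode n (bucket_offsets \<beta> S)"
    have fin: "finite S" using S finite_subset by blast
    have n: "n > 0" using fin q by (auto simp: n_def card_gt_0_iff)
    have "mono \<beta>" by (auto simp: mono_def \<beta>_def linear_mapper_mono)
    have i: "\<beta> q < n" using q S n by (auto simp: \<beta>_def intro!: linear_mapper_less)
    have offsets: "sorted (bucket_offsets \<beta> S)" "\<forall>v\<in>set (bucket_offsets \<beta> S). v \<le> n"
      using fin by (auto simp: sorted_bucket_offsets in_set_conv_nth n_def less_Suc_eq_le bucket_offsets_nth_le)
    have sel: "fst (sel_query I w B (sel_build I w B) j) = bucket_offsets \<beta> S ! j + j \<and>
        snd (sel_query I w B (sel_build I w B) j) \<le> t1" if "j \<le> card S" for j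
    proof -
      \<comment> \<open>The vector has \<open>2 * n + 1\<close> bits, which is why the size
        assumption is strict.\<close>
      have "length B \<le> 2 ^ w" using small by (simp add: B_def n_def)
      moreover have "j < count_list B True" "select1 B j = bucket_offsets \<beta> S ! j + j"
        using that by (simp_all add: B_def count_list_ef_encode[OF offsets] select1_ef_encode[OF offsets])
      ultimately show ?thesis using t1[of B w j] by simp
    qed
    obtain ta where ta: "ef_access I w B (sel_build I w B) (\<beta> q) = (card {x \<in> S. \<beta> x < \<beta> q}, ta)" "ta \<le> t1 + 1"
      using ef_access_bucket_offsets[OF fin small _ sel, of "\<beta> q"] i by (auto simp: n_def)
    \<comment> \<open>The successor of the last bucket is covered too, since there are
      \<open>n + 1\<close> offsets.\<close>
    obtain tb where tb: "ef_access I w B (sel_build I w B) (\<beta> q + 1) = (card {x \<in> S. \<beta> x < \<beta> q + 1}, tb)" "tb \<le> t1 + 1"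
      using ef_access_bucket_offsets[OF fin small _ sel, of "\<beta> q + 1"] i by (auto simp: n_def)
    define b where "b = card (bucket \<beta> S (\<beta> q))"
    have next_offset: "card {x \<in> S. \<beta> x < \<beta> q + 1} = card {x \<in> S. \<beta> x < \<beta> q} + b"
      using sum_card_bucket[OF fin, of \<beta> "\<beta> q + 1"] sum_card_bucket[OF fin, of \<beta> "\<beta> q"] by (simp add: b_def)
    have le: "card {x \<in> S. \<beta> x < \<beta> q} + b \<le> n"
      unfolding next_offset[symmetric] n_def using fin by (intro card_mono) auto
    have "n < 2 ^ w" "\<beta> q + 1 < 2 ^ w" using small i n by (auto simp: n_def)
    have rank: "key_rank S q = card {x \<in> S. \<beta> x < \<beta> q} + local_rank \<beta> S q"
      by (rule key_rank_split[OF fin \<open>mono \<beta>\<close> q])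
    have b_pos: "local_rank \<beta> S q < b" using local_rank_less[OF fin q] by (simp add: b_def)
    have mulhi: "w_mulhi w q n = (\<beta> q, 1)" by (simp add: w_mulhi_def \<beta>_def linear_mapper_eq_div)
    have add1: "w_add w (\<beta> q) 1 = (\<beta> q + 1, 1)" using \<open>\<beta> q + 1 < 2 ^ w\<close> by (simp add: w_add_def)
    have sub: "w_sub w (card {x \<in> S. \<beta> x < \<beta> q + 1}) (card {x \<in> S. \<beta> x < \<beta> q}) = (b, 1)"
      unfolding next_offset using le \<open>n < 2 ^ w\<close> by (simp add: w_sub_eq)
    have L: "num_keys (lemonhash_build I J w S) = n" "offset_code (lemonhash_build I J w S) = B"
        "offset_select (lemonhash_build I J w S) = sel_build I w B"
        "local_ranks (lemonhash_build I J w S) = (\<lambda>i. ret_build J w i (level_keys \<beta> S i) (local_rank \<beta> S))"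
      by (simp_all add: lemonhash_build_def n_def \<beta>_def B_def Let_def)
    show ?thesis
    proof (cases "2 \<le> b")
      case False
      \<comment> \<open>The bucket is the singleton of \<open>q\<close>, so its global rank is
        already the answer.\<close>
      hence "local_rank \<beta> S q = 0" using b_pos by simp
      thus ?thesis using False ta(2) tb(2)
        by (simp add: lemonhash_query_def L load_def bind_timed_def mulhi add1[simplified] ta(1) tb(1)[simplified]
            sub[simplified] w_le_def ret_def rank)
    next
      case True
      have sub1: "w_sub w b 1 = (b - 1, 1)"
        using True le \<open>n < 2 ^ w\<close> by (intro w_sub_eq) linarith+
      have lev: "floor_log (b - 1) + 1 = clog2 b" using True by (simp add: clog2_eq_floor_log)
      have "clog2 b \<le> clog2 (card S)" using le by (intro clog2_mono) (simp add: n_def)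
      note ret = level_keys_retrievable[OF S this]
      have "clog2 b < 2 ^ w" using ret(2) less_exp[of w] by linarith
      hence add_lev: "w_add w (floor_log (b - 1)) 1 = (clog2 b, 1)" by (simp add: w_add_def lev[simplified])
      have "q \<in> level_keys \<beta> S (clog2 b)" using q True by (simp add: level_keys_def b_def)
      from t2[OF ret this] obtain tr where tr:
        "ret_query J w (ret_build J w (clog2 b) (level_keys \<beta> S (clog2 b)) (local_rank \<beta> S)) q = (local_rank \<beta> S q, tr)"
        "tr \<le> t2" by (metis prod.collapse)
      have add_rank: "w_add w (card {x \<in> S. \<beta> x < \<beta> q}) (local_rank \<beta> S q) = (key_rank S q, 1)"
        using le b_pos \<open>n < 2 ^ w\<close> by (simp add: w_add_def rank)
      show ?thesis using True ta(2) tb(2) tr(2)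
        by (simp add: lemonhash_query_def L load_def bind_timed_def mulhi add1[simplified] ta(1) tb(1)[simplified]
            sub[simplified] w_le_def sub1[simplified] w_msb_def add_lev[simplified] tr(1) add_rank)
    qed
  qed
  thus ?thesis by blast
qed

section \<open>Expected space\<close>

text \<open>The finitely many exceptions go into \<open>C\<close>. A bound valid for all
  \<open>n\<close> can be summed over the levels, whose sizes need not grow.\<close>

lemma smallo_real_bound:
  assumes "g \<in> o(\<lambda>n. real n)" "\<epsilon> > 0"
  obtains C where "C \<ge> 0" "\<And>n. g n \<le> \<epsilon> * real n + C"
proof -
  have "eventually (\<lambda>n. norm (g n) \<le> \<epsilon> * norm (real n)) sequentially"
    using landau_o.smallD[OF assms] .
  then obtain N where N: "\<And>n. n \<ge> N \<Longrightarrow> \<bar>g n\<bar> \<le> \<epsilon> * real n"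
    by (auto simp: eventually_sequentially)
  show thesis
  proof (rule that)
    show "(\<Sum>k<N. \<bar>g k\<bar>) \<ge> 0" by (intro sum_nonneg) auto
    fix n show "g n \<le> \<epsilon> * real n + (\<Sum>k<N. \<bar>g k\<bar>)"
    proof (cases "n < N")
      case True
      hence "\<bar>g n\<bar> \<le> (\<Sum>k<N. \<bar>g k\<bar>)" by (intro member_le_sum) auto
      moreover have "0 \<le> \<epsilon> * real n" using assms(2) by simp
      ultimately show ?thesis by linarith
    next
      case False
      have "(\<Sum>k<N. \<bar>g k\<bar>) \<ge> 0" by (intro sum_nonneg) auto
      moreover have "\<bar>g n\<bar> \<le> \<epsilon> * real n" using N False by simp
      ultimately show ?thesis by linarith
    qed
  qed
qed

lemma clog2_Suc_bound:
  assumes "\<epsilon> > 0"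
  obtains C where "C \<ge> 0" "\<And>m. real (clog2 (m + 1)) \<le> \<epsilon> * real m + C"
proof -
  have "(\<lambda>n. ln (real n)) \<in> o(\<lambda>n. real n)"
    by (rule smalloI_tendsto[OF lim_ln_over_n]) (auto simp: eventually_at_top_linorder intro: exI[of _ 1])
  from smallo_real_bound[OF this, of "\<epsilon> * ln 2"] obtain C where C: "C \<ge> 0" "\<And>n. ln (real n) \<le> \<epsilon> * ln 2 * real n + C"
    using assms by auto
  show thesis
  \<comment> \<open>The summand \<open>\<epsilon>\<close> pays for \<open>m + 1\<close> in place of
    \<open>m\<close>, and 1 pays for rounding up.\<close>
  proof (rule that[of "\<epsilon> + C / ln 2 + 1"])
    fix m
    have "real (clog2 (m + 1)) \<le> log 2 (real (m + 1)) + 1"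
      unfolding clog2_def using of_int_ceiling_le_add_one[of "log 2 (real (m + 1))"] by simp
    moreover have "log 2 (real (m + 1)) \<le> \<epsilon> * real (m + 1) + C / ln 2"
      using C(2)[of "m + 1"] by (simp add: log_def field_simps)
    ultimately show "real (clog2 (m + 1)) \<le> \<epsilon> * real m + (\<epsilon> + C / ln 2 + 1)"
      by (simp add: algebra_simps)
  qed (use C assms in auto)
qed

section \<open>The space for a fixed key set\<close>

text \<open>The mapper uses \<open>card S\<close> buckets, so for merged draws it depends on the
  number of distinct keys rather than on the number of draws.\<close>

definition level_sum :: "nat \<Rightarrow> nat set \<Rightarrow> real" where
  "level_sum w S = (\<Sum>j<card S. level_cost (card (bucket (linear_mapper (2 ^ w) (card S)) S j)))"

text \<open>Both sides add up the value width of every key, grouped once by level and once by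
  bucket.\<close>

lemma sum_level_keys:
  assumes "finite S" and "\<And>x. x \<in> S \<Longrightarrow> \<beta> x < card S"
  shows "(\<Sum>i = 1..clog2 (card S). real (i * card (level_keys \<beta> S i)))
       = (\<Sum>j<card S. level_cost (card (bucket \<beta> S j)))"
proof -
  let ?b = "\<lambda>x. card (bucket \<beta> S (\<beta> x))"
  have b: "clog2 (?b x) \<le> clog2 (card S)" for x
    using assms(1) by (intro clog2_mono card_mono) (auto simp: bucket_def)
  have "(\<Sum>i = 1..clog2 (card S). i * card (level_keys \<beta> S i))
      = (\<Sum>i = 1..clog2 (card S). \<Sum>x\<in>S. if ?b x \<ge> 2 \<and> clog2 (?b x) = i then i else 0)"
    using assms(1) by (simp add: level_keys_def mult.commute flip: sum.inter_filter)
  also have "\<dots> = (\<Sum>x\<in>S. \<Sum>i = 1..clog2 (card S). if ?b x \<ge> 2 \<and> clog2 (?b x) = i then i else 0)"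
    by (rule sum.swap)
  also have "\<dots> = (\<Sum>x\<in>S. clog2 (?b x))"
  proof (intro sum.cong refl)
    fix x
    show "(\<Sum>i = 1..clog2 (card S). if ?b x \<ge> 2 \<and> clog2 (?b x) = i then i else 0) = clog2 (?b x)"
    proof (cases "?b x \<ge> 2")
      case True
      hence "clog2 (?b x) \<ge> 1" by (simp add: clog2_eq_floor_log)
      with True b[of x] show ?thesis by simp
    qed simp
  qed
  also have "\<dots> = (\<Sum>j<card S. \<Sum>x | x \<in> S \<and> \<beta> x = j. clog2 (?b x))"
    using assms by (intro sum.group[symmetric]) auto
  also have "\<dots> = (\<Sum>j<card S. card (bucket \<beta> S j) * clog2 (card (bucket \<beta> S j)))"
    by (intro sum.cong refl) (simp add: bucket_def)
  finally have "real (\<Sum>i = 1..clog2 (card S). i * card (level_keys \<beta> S i))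
      = real (\<Sum>j<card S. card (bucket \<beta> S j) * clog2 (card (bucket \<beta> S j)))" by simp
  thus ?thesis by (simp add: level_cost_def)
qed

lemma sum_card_level_keys_le:
  assumes "finite S"
  shows "(\<Sum>i = 1..L. card (level_keys \<beta> S i)) \<le> card S"
proof -
  have "(\<Sum>i = 1..L. card (level_keys \<beta> S i)) = card (\<Union>i\<in>{1..L}. level_keys \<beta> S i)"
    using assms by (intro card_UN_disjoint[symmetric]) (auto simp: level_keys_def)
  also have "\<dots> \<le> card S" using assms by (intro card_mono) (auto simp: level_keys_def)
  finally show ?thesis .
qed

text \<open>The linear part of the retrieval errors adds up to at most \<open>\<eta> * m\<close>, as
  every key is in at most one level. The constant part \<open>C2\<close> is paid once per level, and
  the number of levels is logarithmic.\<close>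

lemma lemonhash_bits_approx:
  assumes "select_structure I" and "retrieval_structure J" and "\<epsilon> > 0"
  obtains K where "\<And>w S. S \<subseteq> {..<2 ^ w} \<Longrightarrow> 2 * card S < 2 ^ w \<Longrightarrow>
    \<bar>real (lemonhash_bits I J (lemonhash_build I J w S)) - (level_sum w S + 2 * real (card S))\<bar>
      \<le> \<epsilon> * real (card S) + K"
proof -
  \<comment> \<open>Five shares: two for select on \<open>2 * m + 1\<close> bits, two for the
    retrieval structures and one for the stored number of keys.\<close>
  define \<eta> where "\<eta> = \<epsilon> / 5"
  have \<eta>: "\<eta> > 0" using assms by (simp add: \<eta>_def)
  obtain g1 where g1: "g1 \<in> o(\<lambda>n. real n)"
    "\<And>w B. length B \<le> 2 ^ w \<Longrightarrow> real (sel_bits I (sel_build I w B)) \<le> g1 (length B)"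
    using select_structureE[OF assms(1)] by metis
  obtain g2 where g2: "g2 \<in> o(\<lambda>n. real n)"
    "\<And>w r K f. K \<subseteq> {..<2 ^ w} \<Longrightarrow> r \<le> w \<Longrightarrow> \<forall>x\<in>K. f x < 2 ^ r \<Longrightarrow>
      \<bar>real (ret_bits J (ret_build J w r K f)) - real (r * card K)\<bar> \<le> g2 (card K)"
    using retrieval_structureE[OF assms(2)] by metis
  obtain C1 where C1: "C1 \<ge> 0" "\<And>n. g1 n \<le> \<eta> * real n + C1" by (rule smallo_real_bound[OF g1(1) \<eta>]) blast
  obtain C2 where C2: "C2 \<ge> 0" "\<And>n. g2 n \<le> \<eta> * real n + C2" by (rule smallo_real_bound[OF g2(1) \<eta>]) blast
  \<comment> \<open>Compensates the factor \<open>C2\<close> paid per level; adding 1 keeps the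
    divisor positive and at least 1.\<close>
  have "\<eta> / (C2 + 1) > 0" using \<eta> C2 by simp
  then obtain C3 where C3: "C3 \<ge> 0" "\<And>m. real (clog2 (m + 1)) \<le> \<eta> / (C2 + 1) * real m + C3"
    by (rule clog2_Suc_bound) blast
  show thesis
  proof (rule that)
    fix w and S :: "nat set"
    assume S: "S \<subseteq> {..<2 ^ w}" and small: "2 * card S < 2 ^ w"
    define m where "m = card S"
    define \<beta> where "\<beta> = linear_mapper (2 ^ w) m"
    define B where "B = ef_encode m (bucket_offsets \<beta> S)"
    define R where "R i = real (ret_bits J (ret_build J w i (level_keys \<beta> S i) (local_rank \<beta> S)))" for i
    have fin: "finite S" using S finite_subset by blast
    have \<beta>: "\<beta> x < card S" if "x \<in> S" for x
      using that S fin by (auto simp: \<beta>_def m_def card_gt_0_iff intro!: linear_mapper_less)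
    have len: "length B = 2 * m + 1" by (simp add: B_def m_def)
    have bits: "real (lemonhash_bits I J (lemonhash_build I J w S)) =
        real (clog2 (m + 1)) + real (2 * m + 1) + real (sel_bits I (sel_build I w B)) + (\<Sum>i = 1..clog2 m. R i)"
      by (simp add: lemonhash_bits_def lemonhash_build_def Let_def R_def B_def \<beta>_def m_def)
    have sel: "real (sel_bits I (sel_build I w B)) \<le> \<eta> * real (2 * m + 1) + C1"
      using g1(2)[of B w] C1(2)[of "length B"] small by (simp add: len m_def)
    have "\<bar>(\<Sum>i = 1..clog2 m. R i) - level_sum w S\<bar>
        = \<bar>\<Sum>i = 1..clog2 m. R i - real (i * card (level_keys \<beta> S i))\<bar>"
      using sum_level_keys[OF fin \<beta>] by (simp add: sum_subtractf level_sum_def \<beta>_def m_def)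
    also have "\<dots> \<le> (\<Sum>i = 1..clog2 m. \<eta> * real (card (level_keys \<beta> S i)) + C2)"
    proof (intro order_trans[OF sum_abs] sum_mono)
      fix i assume i: "i \<in> {1..clog2 m}"
      hence "i \<le> clog2 (card S)" by (simp add: m_def)
      note ret = level_keys_retrievable[OF S this]
      show "\<bar>R i - real (i * card (level_keys \<beta> S i))\<bar> \<le> \<eta> * real (card (level_keys \<beta> S i)) + C2"
        unfolding R_def using g2(2)[OF ret] C2(2) order_trans by blast
    qed
    also have "\<dots> = \<eta> * real (\<Sum>i = 1..clog2 m. card (level_keys \<beta> S i)) + C2 * real (clog2 m)"
      by (simp add: sum.distrib sum_distrib_left)
    also have "\<dots> \<le> \<eta> * real m + (C2 + 1) * real (clog2 (m + 1))"
    proof (intro add_mono mult_mono)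
      show "real (\<Sum>i = 1..clog2 m. card (level_keys \<beta> S i)) \<le> real m"
        using sum_card_level_keys_le[OF fin] unfolding m_def by (rule of_nat_mono)
      show "real (clog2 m) \<le> real (clog2 (m + 1))" by (intro of_nat_mono clog2_mono) simp
    qed (use \<eta> C2 in \<open>auto intro!: sum_nonneg\<close>)
    also have "\<dots> \<le> \<eta> * real m + (C2 + 1) * (\<eta> / (C2 + 1) * real m + C3)"
      using C2 C3(2) by (intro add_left_mono mult_left_mono) auto
    also have "\<dots> = 2 * \<eta> * real m + (C2 + 1) * C3"
    proof -
      have "C2 + 1 \<noteq> 0" using C2 by linarith
      thus ?thesis by (simp add: field_simps)
    qed
    finally have main: "\<bar>(\<Sum>i = 1..clog2 m. R i) - level_sum w S\<bar> \<le> 2 * \<eta> * real m + (C2 + 1) * C3" .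
    have "real (clog2 (m + 1)) \<le> \<eta> * real m + C3"
    proof -
      have "\<eta> / (C2 + 1) * real m \<le> \<eta> / 1 * real m"
        using C2 \<eta> by (intro mult_right_mono divide_left_mono) auto
      thus ?thesis using C3(2)[of m] by simp
    qed
    with main sel show "\<bar>real (lemonhash_bits I J (lemonhash_build I J w S)) - (level_sum w S + 2 * real (card S))\<bar>
        \<le> \<epsilon> * real (card S) + ((C2 + 1) * C3 + C3 + \<eta> + C1 + 1)"
      unfolding bits m_def[symmetric] by (simp add: \<eta>_def abs_le_iff algebra_simps)
  qed
qed

section \<open>Mean space under the linear mapper\<close>

text \<open>A bucket consists of the integers in a half-open interval of length
  \<open>u / m\<close>, and taking ceilings of both ends changes the length by at most 1.\<close>

lemma card_linear_bucket:
  assumes "j < m" "0 < u"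
  shows "\<bar>real (card {x. x < u \<and> linear_mapper u m x = j}) - real u / real m\<bar> \<le> 1"
    and "card {x. x < u \<and> linear_mapper u m x = j} \<le> u"
proof -
  have m: "real m > 0" using assms by simp
  define r where "r = real j * real u / real m"
  define s where "s = real (j + 1) * real u / real m"
  have rs: "0 \<le> r" "r \<le> s" "s - r = real u / real m"
    using m by (auto simp: r_def s_def divide_simps algebra_simps)
  have "{x. x < u \<and> linear_mapper u m x = j} = {nat \<lceil>r\<rceil>..<nat \<lceil>s\<rceil>}"
  proof (intro set_eqI)
    fix x
    have "x * m div u = j \<longleftrightarrow> j * u \<le> x * m \<and> x * m < (j + 1) * u"
    proof
      assume "x * m div u = j"
      thus "j * u \<le> x * m \<and> x * m < (j + 1) * u"
        using assms(2) div_times_less_eq_dividend[of "x * m" u] dividend_less_div_times[of u "x * m"]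
        by auto
    next
      assume "j * u \<le> x * m \<and> x * m < (j + 1) * u"
      thus "x * m div u = j"
        by (intro div_nat_eqI) (auto simp: mult.commute)
    qed
    also have "\<dots> \<longleftrightarrow> real (j * u) \<le> real (x * m) \<and> real (x * m) < real ((j + 1) * u)"
      by (simp only: of_nat_le_iff of_nat_less_iff)
    also have "\<dots> \<longleftrightarrow> r \<le> real x \<and> real x < s"
      using m by (simp add: r_def s_def pos_divide_le_eq pos_less_divide_eq distrib_right)
    also have "\<dots> \<longleftrightarrow> nat \<lceil>r\<rceil> \<le> x \<and> \<not> nat \<lceil>s\<rceil> \<le> x"
      by (simp add: nat_ceiling_le_eq linorder_not_le[symmetric] del: linorder_not_le)
    finally have iff: "x * m div u = j \<longleftrightarrow> x \<in> {nat \<lceil>r\<rceil>..<nat \<lceil>s\<rceil>}"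
      by (simp only: atLeastLessThan_iff not_le)
    \<comment> \<open>The restriction to the universe is automatic because
      \<open>j < m\<close>.\<close>
    moreover have "x < u" if "x * m div u = j"
    proof (rule ccontr)
      assume "\<not> x < u"
      hence "u * m div u \<le> x * m div u" by (intro div_le_mono mult_le_mono1) simp
      thus False using that assms by simp
    qed
    ultimately show "x \<in> {x. x < u \<and> linear_mapper u m x = j} \<longleftrightarrow> x \<in> {nat \<lceil>r\<rceil>..<nat \<lceil>s\<rceil>}"
      by (auto simp: linear_mapper_eq_div)
  qed
  hence "real (card {x. x < u \<and> linear_mapper u m x = j}) = real (nat \<lceil>s\<rceil> - nat \<lceil>r\<rceil>)" by simp
  also have "\<dots> = of_int \<lceil>s\<rceil> - of_int \<lceil>r\<rceil>"
  proof -
    have "nat \<lceil>r\<rceil> \<le> nat \<lceil>s\<rceil>" using rs(2) by (intro nat_mono ceiling_mono)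
    moreover have "real (nat \<lceil>r\<rceil>) = of_int \<lceil>r\<rceil>" "real (nat \<lceil>s\<rceil>) = of_int \<lceil>s\<rceil>"
      using rs(1,2) by simp_all
    ultimately show ?thesis by (simp add: of_nat_diff)
  qed
  finally show "\<bar>real (card {x. x < u \<and> linear_mapper u m x = j}) - real u / real m\<bar> \<le> 1"
    using rs(3) by linarith
  show "card {x. x < u \<and> linear_mapper u m x = j} \<le> u"
    using card_mono[of "{..<u}" "{x. x < u \<and> linear_mapper u m x = j}"] by auto
qed

text \<open>For sets of fixed size \<open>m\<close> the mapper is fixed, so each bucket is the
  intersection of \<open>S\<close> with a fixed set and its size is hypergeometric.\<close>

lemma avg_level_sum:
  assumes "m \<le> 2 ^ w"
  shows "avg (2 ^ w) m (level_sum w) =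
    (\<Sum>j<m. hyp_series level_cost (2 ^ w) (card {x. x < 2 ^ w \<and> linear_mapper (2 ^ w) m x = j}) m)"
proof -
  let ?A = "\<lambda>j. {x. x < 2 ^ w \<and> linear_mapper (2 ^ w) m x = j}"
  have "avg (2 ^ w) m (level_sum w) = avg (2 ^ w) m (\<lambda>S. \<Sum>j<m. level_cost (card (S \<inter> ?A j)))"
  proof (rule avg_cong)
    fix S assume "S \<in> ksubsets (2 ^ w) m"
    hence S: "S \<subseteq> {..<2 ^ w}" "card S = m" by (auto simp: ksubsets_def)
    hence "bucket (linear_mapper (2 ^ w) m) S j = S \<inter> ?A j" for j by (auto simp: bucket_def)
    thus "level_sum w S = (\<Sum>j<m. level_cost (card (S \<inter> ?A j)))" using S by (simp add: level_sum_def)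
  qed
  also have "\<dots> = (\<Sum>j<m. avg (2 ^ w) m (\<lambda>S. level_cost (card (S \<inter> ?A j))))" by (rule avg_sum)
  also have "\<dots> = (\<Sum>j<m. hyp_series level_cost (2 ^ w) (card (?A j)) m)"
    using assms by (intro sum.cong refl avg_eq_hyp_series) auto
  finally show ?thesis .
qed

text \<open>A crude bound, used only for boundedly many keys, where it contributes a
  constant.\<close>

lemma level_sum_bounds: "0 \<le> level_sum w S" "level_sum w S \<le> real (card S) ^ 3"
proof -
  show "0 \<le> level_sum w S" by (auto simp: level_sum_def level_cost_def intro!: sum_nonneg)
  have "level_sum w S \<le> (\<Sum>j<card S. real (card S * card S))"
    unfolding level_sum_def level_cost_def of_nat_mult[symmetric]
  proof (intro sum_mono of_nat_mono mult_mono)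
    fix j assume j: "j \<in> {..<card S}"
    hence "finite S" by (auto intro: card_ge_0_finite)
    thus b: "card (bucket (linear_mapper (2 ^ w) (card S)) S j) \<le> card S"
      by (intro card_mono) (auto simp: bucket_def)
    show "clog2 (card (bucket (linear_mapper (2 ^ w) (card S)) S j)) \<le> card S"
      using b clog2_le_self order_trans by blast
  qed auto
  thus "level_sum w S \<le> real (card S) ^ 3" by (simp add: power3_eq_cube)
qed

text \<open>From \<open>N\<close> keys on, each of the \<open>m\<close> buckets contributes at most
  \<open>\<epsilon>\<close> to the error; smaller key sets are absorbed in \<open>K\<close>.\<close>

lemma avg_level_sum_approx:
  assumes "\<epsilon> > 0"
  obtains \<delta> K where "\<delta> > 0" "\<And>w m. real m \<le> \<delta> * 2 ^ w \<Longrightarrow>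
    \<bar>avg (2 ^ w) m (level_sum w) - level_const * real m\<bar> \<le> \<epsilon> * real m + K"
proof -
  obtain N :: nat where N: "\<And>u s m. N \<le> s \<Longrightarrow> N \<le> m \<Longrightarrow> s \<le> u \<Longrightarrow>
      \<bar>real s * real m / real u - 1\<bar> \<le> 1 / real (Suc N) \<Longrightarrow>
      \<bar>hyp_series level_cost u s m - level_const\<bar> \<le> \<epsilon>"
    unfolding level_const_def by (rule hyp_series_uniform[OF abs_level_cost_le _ assms]) auto
  show thesis
  proof (rule that)
    \<comment> \<open>This \<open>\<delta>\<close> forces \<open>u / m \<ge> N + 1\<close>, hence at
      least \<open>N\<close> universe elements per bucket despite rounding, and it bounds the
      relative deviation \<open>m / u\<close> of the bucket sizes.\<close>
    show "1 / real (Suc N) > 0" by simp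
    fix w m
    assume m: "real m \<le> 1 / real (Suc N) * 2 ^ w"
    define u :: nat where "u = 2 ^ w"
    have u: "u > 0" by (simp add: u_def)
    have mu: "real m / real u \<le> 1 / real (Suc N)"
      using m by (simp add: u_def divide_simps mult_ac)
    have "real m \<le> 1 * 2 ^ w" using m by (rule order_trans) (intro mult_right_mono, auto)
    hence "real m \<le> real (2 ^ w)" by simp
    hence le: "m \<le> 2 ^ w" by (simp only: of_nat_le_iff)
    show "\<bar>avg (2 ^ w) m (level_sum w) - level_const * real m\<bar>
        \<le> \<epsilon> * real m + (real N ^ 3 + \<bar>level_const\<bar> * real N)"
    proof (cases "N \<le> m \<and> m > 0")
      case True
      have "\<bar>avg (2 ^ w) m (level_sum w) - level_const * real m\<bar>
          = \<bar>\<Sum>j<m. hyp_series level_cost u (card {x. x < u \<and> linear_mapper u m x = j}) m - level_const\<bar>"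
        by (simp add: avg_level_sum[OF le] sum_subtractf u_def mult.commute)
      also have "\<dots> \<le> (\<Sum>j<m. \<epsilon>)"
      proof (intro order_trans[OF sum_abs] sum_mono)
        fix j assume "j \<in> {..<m}"
        hence j: "j < m" by simp
        define s where "s = card {x. x < u \<and> linear_mapper u m x = j}"
        note s = card_linear_bucket[OF j u, folded s_def]
        have "real (Suc N) \<le> real u / real m"
          using mu True u by (simp add: field_simps)
        hence "real N \<le> real s" using s(1) by simp
        hence "N \<le> s" by simp
        moreover have "\<bar>real s * real m / real u - 1\<bar> \<le> 1 / real (Suc N)"
        proof -
          have "real s * real m / real u - 1 = (real s - real u / real m) * (real m / real u)"
            using True u by (simp add: field_simps)
          also have "\<bar>\<dots>\<bar> \<le> 1 * (real m / real u)"
            unfolding abs_mult using s(1) by (intro mult_mono) auto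
          finally show ?thesis using mu by simp
        qed
        ultimately show "\<bar>hyp_series level_cost u s m - level_const\<bar> \<le> \<epsilon>"
          using True s(2) by (intro N) auto
      qed
      also have "\<dots> \<le> \<epsilon> * real m + (real N ^ 3 + \<bar>level_const\<bar> * real N)"
        by (simp add: add_nonneg_nonneg)
      finally show ?thesis .
    next
      case False
      hence mN: "real m \<le> real N" by auto
      have "\<bar>avg (2 ^ w) m (level_sum w) - (avg (2 ^ w) m (\<lambda>_. 0) + 0)\<bar> \<le> real N ^ 3"
      proof (rule avg_diff_const_le[OF le])
        fix S assume "S \<in> ksubsets (2 ^ w) m"
        hence "real (card S) ^ 3 \<le> real N ^ 3" using mN by (intro power_mono) (auto simp: ksubsets_def)
        hence "\<bar>level_sum w S\<bar> \<le> real N ^ 3" using level_sum_bounds[of w S] by linarith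
        thus "\<bar>level_sum w S - (0 + 0)\<bar> \<le> real N ^ 3" by simp
      qed
      moreover have "\<bar>level_const * real m\<bar> \<le> \<bar>level_const\<bar> * real N"
        unfolding abs_mult using mN by (intro mult_left_mono) auto
      moreover have "0 \<le> \<epsilon> * real m" using assms by simp
      moreover have "avg (2 ^ w) m (\<lambda>_. 0) = 0" by (simp add: avg_def)
      ultimately show ?thesis by linarith
    qed
  qed
qed

lemma avg_bits_approx:
  assumes "select_structure I" and "retrieval_structure J" and "\<epsilon> > 0"
  obtains \<delta> K where "\<delta> > 0" "\<And>w m. real m \<le> \<delta> * 2 ^ w \<Longrightarrow>
    \<bar>avg (2 ^ w) m (\<lambda>S. real (lemonhash_bits I J (lemonhash_build I J w S)))
       - (level_const + 2) * real m\<bar> \<le> \<epsilon> * real m + K"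
proof -
  have e: "\<epsilon> / 2 > 0" using assms by simp
  obtain \<delta> K1 where \<delta>: "\<delta> > 0" and K1: "\<And>w m. real m \<le> \<delta> * 2 ^ w \<Longrightarrow>
    \<bar>avg (2 ^ w) m (level_sum w) - level_const * real m\<bar> \<le> \<epsilon> / 2 * real m + K1"
    by (rule avg_level_sum_approx[OF e]) blast
  obtain K2 where K2: "\<And>w S. S \<subseteq> {..<2 ^ w} \<Longrightarrow> 2 * card S < 2 ^ w \<Longrightarrow>
    \<bar>real (lemonhash_bits I J (lemonhash_build I J w S)) - (level_sum w S + 2 * real (card S))\<bar>
      \<le> \<epsilon> / 2 * real (card S) + K2"
    by (rule lemonhash_bits_approx[OF assms(1,2) e]) blast
  show thesis
  proof (rule that)
    \<comment> \<open>The cap 1/3 ensures \<open>2 * m < 2 ^ w\<close>, as the space bound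
      requires.\<close>
    show "min \<delta> (1 / 3) > 0" using \<delta> by simp
    fix w m assume "real m \<le> min \<delta> (1 / 3) * 2 ^ w"
    moreover have "min \<delta> (1 / 3) * 2 ^ w \<le> \<delta> * 2 ^ w" "min \<delta> (1 / 3) * 2 ^ w \<le> (1 / 3) * 2 ^ w"
      by (intro mult_right_mono; simp)+
    ultimately have m: "real m \<le> \<delta> * 2 ^ w" "real m \<le> (1 / 3) * 2 ^ w" by linarith+
    have "(0::real) < 2 ^ w" by simp
    hence "2 * real m < 2 ^ w" using m(2) by linarith
    hence "real (2 * m) < real (2 ^ w)" by simp
    hence small: "2 * m < 2 ^ w" by (simp only: of_nat_less_iff)
    have "\<bar>avg (2 ^ w) m (\<lambda>S. real (lemonhash_bits I J (lemonhash_build I J w S)))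
        - (avg (2 ^ w) m (level_sum w) + 2 * real m)\<bar> \<le> \<epsilon> / 2 * real m + K2"
      using small K2 by (intro avg_diff_const_le) (auto simp: ksubsets_def)
    with K1[OF m(1)] show "\<bar>avg (2 ^ w) m (\<lambda>S. real (lemonhash_bits I J (lemonhash_build I J w S)))
       - (level_const + 2) * real m\<bar> \<le> \<epsilon> * real m + (K1 + K2)"
      by (simp add: abs_le_iff algebra_simps)
  qed
qed

section \<open>Convergence of the expected space\<close>

lemma expectation_bound:
  fixes f :: "'a \<Rightarrow> real"
  assumes "finite (set_pmf p)" "\<And>x. x \<in> set_pmf p \<Longrightarrow> \<bar>f x\<bar> \<le> c"
  shows "\<bar>measure_pmf.expectation p f\<bar> \<le> c"
proof -
  have int: "integrable (measure_pmf p) f" using assms(1) by (rule integrable_measure_pmf_finite)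
  have "measure_pmf.expectation p f \<le> c"
    using assms by (intro measure_pmf.integral_le_const int) (auto simp: AE_measure_pmf_iff abs_le_iff)
  moreover have "- c \<le> measure_pmf.expectation p f"
    using assms by (intro measure_pmf.integral_ge_const int) (auto simp: AE_measure_pmf_iff abs_le_iff minus_le_iff)
  ultimately show ?thesis by (simp add: abs_le_iff)
qed

text \<open>Conditioning on the cardinality reduces the claim to uniform subsets. The three shares
  \<open>\<epsilon> / 3\<close> cover the error at fixed cardinality, the additive constant, and the
  keys lost to repeated draws.\<close>

lemma expected_bits:
  fixes w :: "nat \<Rightarrow> nat"
  assumes "select_structure I" and "retrieval_structure J"
    and w: "filterlim (\<lambda>n. 2 ^ w n / real n) at_top sequentially"
    and \<D>: "\<D> \<in> {distinct_key_set, merged_key_set}"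
  shows "(\<lambda>n. measure_pmf.expectation (\<D> (2 ^ w n) n)
            (\<lambda>S. real (lemonhash_bits I J (lemonhash_build I J (w n) S)))
          - (level_const + 2) * real n) \<in> o(\<lambda>n. real n)"
proof (rule landau_o.smallI)
  fix \<epsilon> :: real assume \<epsilon>: "\<epsilon> > 0"
  define c where "c = level_const + 2"
  \<comment> \<open>Positivity lets bounds on the expected cardinality be multiplied by
    \<open>c\<close>.\<close>
  have c: "c > 0" using level_const_bounds unfolding c_def abs_le_iff by simp
  have e: "\<epsilon> / 3 > 0" using \<epsilon> by simp
  obtain \<delta> K where \<delta>: "\<delta> > 0" and K: "\<And>w m. real m \<le> \<delta> * 2 ^ w \<Longrightarrow>
    \<bar>avg (2 ^ w) m (\<lambda>S. real (lemonhash_bits I J (lemonhash_build I J w S))) - c * real m\<bar>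
      \<le> \<epsilon> / 3 * real m + K"
    unfolding c_def by (rule avg_bits_approx[OF assms(1,2) e]) blast
  \<comment> \<open>The three thresholds give \<open>n \<le> u\<close>,
    \<open>n \<le> \<delta> * u\<close> and \<open>c * n / u \<le> \<epsilon> / 3\<close>, in this
    order.\<close>
  have "eventually (\<lambda>n. 2 ^ w n / real n \<ge> max (max 1 (1 / \<delta>)) (3 * c / \<epsilon>)) sequentially"
    using w unfolding filterlim_at_top by blast
  moreover have "eventually (\<lambda>n. real n \<ge> 3 * K / \<epsilon>) sequentially"
    using filterlim_real_sequentially by (simp add: filterlim_at_top)
  moreover have "eventually (\<lambda>n. n > 0) sequentially" by (rule eventually_gt_at_top)
  ultimately show "eventually (\<lambda>n. norm (measure_pmf.expectation (\<D> (2 ^ w n) n)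
            (\<lambda>S. real (lemonhash_bits I J (lemonhash_build I J (w n) S)))
          - (level_const + 2) * real n) \<le> \<epsilon> * norm (real n)) sequentially"
  proof eventually_elim
    case (elim n)
    define u :: nat where "u = 2 ^ w n"
    define D where "D = \<D> u n"
    define G where "G S = real (lemonhash_bits I J (lemonhash_build I J (w n) S))" for S
    have u: "u > 0" by (simp add: u_def)
    have ratio: "1 \<le> real u / real n" "1 / \<delta> \<le> real u / real n" "3 * c / \<epsilon> \<le> real u / real n"
      using elim(1) by (auto simp: u_def)
    have "real n \<le> real u" and n\<delta>: "real n \<le> \<delta> * real u" and nc: "c * real n / real u \<le> \<epsilon> / 3"
      using ratio elim(3) \<delta> \<epsilon> u by (auto simp: field_simps)
    hence nu: "n \<le> u" by simp
    note D = key_set_expectation[OF u nu \<D>, folded D_def]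
    have fin: "finite (set_pmf D)"
      using D(1) by (rule finite_subset) (auto intro: finite_subset[of _ "Pow {..<u}"])
    have int: "integrable (measure_pmf D) f" for f :: "nat set \<Rightarrow> real"
      using fin by (rule integrable_measure_pmf_finite)
    have "\<bar>measure_pmf.expectation D (\<lambda>S. avg u (card S) G - c * real (card S))\<bar> \<le> \<epsilon> / 3 * real n + K"
    proof (rule expectation_bound[OF fin])
      fix S assume "S \<in> set_pmf D"
      hence le: "real (card S) \<le> real n" using D(1) by auto
      hence "\<bar>avg u (card S) G - c * real (card S)\<bar> \<le> \<epsilon> / 3 * real (card S) + K"
        using K[of "card S" "w n"] n\<delta> unfolding G_def u_def by simp
      also have "\<dots> \<le> \<epsilon> / 3 * real n + K" using le \<epsilon> by simp
      finally show "\<bar>avg u (card S) G - c * real (card S)\<bar> \<le> \<epsilon> / 3 * real n + K" .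
    qed
    moreover have "measure_pmf.expectation D (\<lambda>S. avg u (card S) G - c * real (card S))
        = measure_pmf.expectation D G - c * measure_pmf.expectation D (\<lambda>S. real (card S))"
      unfolding D(2)[of G] using int by simp
    ultimately have 1: "\<bar>measure_pmf.expectation D G - c * measure_pmf.expectation D (\<lambda>S. real (card S))\<bar>
        \<le> \<epsilon> / 3 * real n + K" by simp
    have "measure_pmf.expectation D (\<lambda>S. real (card S)) \<le> real n"
      using D(1) by (intro measure_pmf.integral_le_const int) (auto simp: AE_measure_pmf_iff)
    hence 2: "c * measure_pmf.expectation D (\<lambda>S. real (card S)) \<le> c * real n" using c by simp
    have "c * (real n - real n ^ 2 / real u) \<le> c * measure_pmf.expectation D (\<lambda>S. real (card S))"
      using key_set_card_expectation_ge[OF u nu \<D>] c by (intro mult_left_mono) (auto simp: D_def)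
    moreover have "c * (real n - real n ^ 2 / real u) = c * real n - c * real n / real u * real n"
      by (simp add: algebra_simps power2_eq_square)
    moreover have "c * real n / real u * real n \<le> \<epsilon> / 3 * real n" using nc by (intro mult_right_mono) auto
    ultimately have 3: "c * real n - \<epsilon> / 3 * real n \<le> c * measure_pmf.expectation D (\<lambda>S. real (card S))"
      by linarith
    have "K \<le> \<epsilon> / 3 * real n" using elim(2) \<epsilon> by (simp add: field_simps)
    with 1 2 3 have "\<bar>measure_pmf.expectation D G - c * real n\<bar> \<le> \<epsilon> * real n" by linarith
    thus ?case by (simp add: D_def G_def[abs_def] u_def c_def)
  qed
qed

theorem theorem1:
  fixes I :: "'s select_impl" and J :: "'r retrieval_impl"
  assumes "select_structure I" and "retrieval_structure J"
  shows "(\<exists>c :: real. \<bar>c - 2.91536\<bar> \<le> 0.000005 \<and>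
            (\<forall>w :: nat \<Rightarrow> nat. filterlim (\<lambda>n. 2 ^ w n / real n) at_top sequentially \<longrightarrow>
               (\<forall>\<D> \<in> {distinct_key_set, merged_key_set}.
                  (\<lambda>n. measure_pmf.expectation (\<D> (2 ^ w n) n)
                           (\<lambda>S. real (lemonhash_bits I J (lemonhash_build I J (w n) S)))
                         - c * real n) \<in> o(\<lambda>n. real n)))) \<and>
         (\<exists>t. \<forall>w S q. S \<subseteq> {..<2 ^ w} \<and> 2 * card S < 2 ^ w \<and> q \<in> S \<longrightarrow>
            fst (lemonhash_query I J w (lemonhash_build I J w S) q) = key_rank S q \<and>
            snd (lemonhash_query I J w (lemonhash_build I J w S) q) \<le> t)"
\<comment> \<open>The 2 is the Elias-Fano share. The witness depends on neither the word sizes nor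
  the model of the keys.\<close>
proof (intro conjI exI[of _ "level_const + 2"] allI impI ballI)
  have "level_const + 2 - 2.91536 = level_const - 0.91536" by simp
  thus "\<bar>level_const + 2 - 2.91536\<bar> \<le> 0.000005" using level_const_bounds by simp
qed (use expected_bits[OF assms] lemonhash_query_correct[OF assms] in blast)+

end
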